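(* Let $\Omega$ be a bounded pseudoconvex domain in $\mathbb{C}^n$, let $0\leq p\leq n$ and $1\leq q\leq n$ be integers, and let $\phi\in C(\Omega)\cap L^\infty(\Omega)$. Then the Toeplitz operator $T^{p,q}_\phi$ is compact on $K^2_{(p,q)}(\Omega)$ if and only if $\phi=0$ on $\Omega$.
   Context: $L^2_{(p,q)}(\Omega)$ is the Hilbert space of $(p,q)$-forms on $\Omega$ with square integrable coefficients (Lebesgue measure), and $K^2_{(p,q)}(\Omega)\subset L^2_{(p,q)}(\Omega)$ is the closed subspace of $\overline{\partial}$-closed forms ($\overline{\partial}$ in the sense of distributions). $P^{p,q}:L^2_{(p,q)}(\Omega)\to K^2_{(p,q)}(\Omega)$ is the orthogonal projection. For $\phi\in L^\infty(\Omega)$, $T^{p,q}_\phi:K^2_{(p,q)}(\Omega)\to K^2_{(p,q)}(\Omega)$ is defined by $T^{p,q}_\phi f=P^{p,q}(\phi f)$. *)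

theory Defs
  imports "HOL-Analysis.Analysis"
begin

subsection \<open>Bounded pseudoconvex domains\<close>

definition domain_set :: "'a::topological_space set \<Rightarrow> bool" where
  "domain_set \<Omega> \<longleftrightarrow> open \<Omega> \<and> connected \<Omega> \<and> \<Omega> \<noteq> {}"

text \<open>Only continuous real-valued (pluri)subharmonic functions are needed, since they serve as
  exhaustion functions; for continuous integrands the circle means below are genuine integrals.\<close>

definition cont_subharmonic_on :: "complex set \<Rightarrow> (complex \<Rightarrow> real) \<Rightarrow> bool" where
  "cont_subharmonic_on U v \<longleftrightarrow>
     continuous_on U v \<and>
     (\<forall>a r. 0 < r \<longrightarrow> cball a r \<subseteq> U \<longrightarrow>
        v a \<le> 1 / (2 * pi) * integral {0..2 * pi} (\<lambda>t. v (a + of_real r * cis t)))"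

definition cont_plurisubharmonic_on :: "(complex ^ 'n) set \<Rightarrow> (complex ^ 'n \<Rightarrow> real) \<Rightarrow> bool" where
  "cont_plurisubharmonic_on \<Omega> u \<longleftrightarrow>
     continuous_on \<Omega> u \<and>
     (\<forall>z w. cont_subharmonic_on {\<tau>. z + \<tau> *s w \<in> \<Omega>} (\<lambda>\<tau>. u (z + \<tau> *s w)))"

definition pseudoconvex :: "(complex ^ 'n) set \<Rightarrow> bool" where
  "pseudoconvex \<Omega> \<longleftrightarrow>
     (\<exists>u. cont_plurisubharmonic_on \<Omega> u \<and>
        (\<forall>c. compact (closure {z \<in> \<Omega>. u z < c}) \<and> closure {z \<in> \<Omega>. u z < c} \<subseteq> \<Omega>))"

subsection \<open>Test functions\<close>

fun Ck :: "nat \<Rightarrow> ('a::real_normed_vector \<Rightarrow> 'b::real_normed_vector) \<Rightarrow> bool" where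
  "Ck 0 f \<longleftrightarrow> continuous_on UNIV f"
| "Ck (Suc k) f \<longleftrightarrow>
     (\<forall>x. f differentiable (at x)) \<and> (\<forall>v. Ck k (\<lambda>x. frechet_derivative f (at x) v))"

definition test_functions :: "(complex ^ 'n) set \<Rightarrow> (complex ^ 'n \<Rightarrow> complex) set" where
  "test_functions \<Omega> =
     {\<psi>. (\<forall>k. Ck k \<psi>) \<and> compact (closure {z. \<psi> z \<noteq> 0}) \<and> closure {z. \<psi> z \<noteq> 0} \<subseteq> \<Omega>}"

text \<open>The Wirtinger derivative \<open>\<partial>\<psi>/\<partial>\<zeta>\<close> with respect to the conjugate \<open>\<zeta>\<close> of the \<open>j\<close>-th coordinate,
  i.e. \<open>(\<partial>/\<partial>x\<^sub>j + \<i> \<partial>/\<partial>y\<^sub>j) / 2\<close>.\<close>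

definition dbar_partial :: "'n \<Rightarrow> (complex ^ 'n \<Rightarrow> complex) \<Rightarrow> complex ^ 'n \<Rightarrow> complex" where
  "dbar_partial j \<psi> z =
     (frechet_derivative \<psi> (at z) (axis j 1) + \<i> * frechet_derivative \<psi> (at z) (axis j \<i>)) / 2"

subsection \<open>Square integrable forms\<close>

text \<open>A form \<open>f\<close> is given by its coefficients: \<open>f z I J\<close> is the coefficient of
  \<open>dz\<^sub>I \<and> d\<zeta>\<^sub>J\<close> (with \<open>\<zeta>\<close> the conjugate of \<open>z\<close>), the factors being taken in increasing order, so that
  subsets \<open>I\<close>, \<open>J\<close> of the linearly ordered index type are the increasing multi-indices.
  A \<open>(p,q)\<close>-form has zero coefficients unless \<open>|I| = p\<close> and \<open>|J| = q\<close>.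
  Elements of \<open>L\<^sup>2\<close> are represented by functions, on which \<open>L2_norm\<close> is a seminorm whose kernel is
  equality almost everywhere on \<open>\<Omega>\<close>.\<close>

type_synonym 'n form = "(complex, 'n) vec \<Rightarrow> 'n set \<Rightarrow> 'n set \<Rightarrow> complex"

definition L2_forms :: "(complex ^ 'n) set \<Rightarrow> nat \<Rightarrow> nat \<Rightarrow> 'n form set" where
  "L2_forms \<Omega> p q =
     {f. (\<forall>z I J. f z I J \<noteq> 0 \<longrightarrow> card I = p \<and> card J = q) \<and>
         (\<forall>I J. (\<lambda>z. f z I J) \<in> borel_measurable (lebesgue_on \<Omega>) \<and>
                integrable (lebesgue_on \<Omega>) (\<lambda>z. (cmod (f z I J))\<^sup>2))}"

definition L2_inner :: "(complex ^ 'n) set \<Rightarrow> 'n form \<Rightarrow> 'n form \<Rightarrow> complex" where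
  "L2_inner \<Omega> f g =
     (\<Sum>I\<in>UNIV. \<Sum>J\<in>UNIV. integral\<^sup>L (lebesgue_on \<Omega>) (\<lambda>z. f z I J * cnj (g z I J)))"

definition L2_norm :: "(complex ^ 'n) set \<Rightarrow> 'n form \<Rightarrow> real" where
  "L2_norm \<Omega> f = sqrt (\<Sum>I\<in>UNIV. \<Sum>J\<in>UNIV. integral\<^sup>L (lebesgue_on \<Omega>) (\<lambda>z. (cmod (f z I J))\<^sup>2))"

definition form_diff :: "'n form \<Rightarrow> 'n form \<Rightarrow> 'n form" where
  "form_diff f g = (\<lambda>z I J. f z I J - g z I J)"

definition form_mult :: "(complex ^ 'n \<Rightarrow> complex) \<Rightarrow> 'n form \<Rightarrow> 'n form" where
  "form_mult \<phi> f = (\<lambda>z I J. \<phi> z * f z I J)"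

text \<open>The coefficient of \<open>dz\<^sub>I \<and> d\<zeta>\<^sub>M\<close> in the distributional \<open>\<partial>\<close>-bar of a \<open>(p,q)\<close>-form \<open>f\<close>, evaluated
  at the test function \<open>\<psi>\<close>. For smooth \<open>f\<close> this coefficient is
  \<open>(-1)\<^sup>p \<Sum>j\<in>M. (-1)^|{k\<in>M. k < j}| \<partial>f(I, M - {j})/\<partial>\<zeta>\<^sub>j\<close>: moving \<open>d\<zeta>\<^sub>j\<close> past \<open>dz\<^sub>I\<close> gives \<open>(-1)\<^sup>p\<close>, and
  moving it to its place in \<open>d\<zeta>\<^sub>M\<close> gives the other sign. The leading minus sign comes from
  integration by parts.\<close>

definition weak_dbar ::
  "(complex ^ 'n::{finite,linorder}) set \<Rightarrow> nat \<Rightarrow> 'n form \<Rightarrow> 'n set \<Rightarrow> 'n set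
     \<Rightarrow> (complex ^ 'n::{finite,linorder} \<Rightarrow> complex) \<Rightarrow> complex" where
  "weak_dbar \<Omega> p f I M \<psi> =
     - ((-1) ^ p * (\<Sum>j\<in>M. (-1) ^ card {k\<in>M. k < j} *
          integral\<^sup>L (lebesgue_on \<Omega>) (\<lambda>z. f z I (M - {j}) * dbar_partial j \<psi> z)))"

definition K2_forms :: "(complex ^ 'n::{finite,linorder}) set \<Rightarrow> nat \<Rightarrow> nat \<Rightarrow> 'n form set" where
  "K2_forms \<Omega> p q =
     {f \<in> L2_forms \<Omega> p q.
        \<forall>I M. card I = p \<longrightarrow> card M = q + 1 \<longrightarrow>
          (\<forall>\<psi> \<in> test_functions \<Omega>. weak_dbar \<Omega> p f I M \<psi> = 0)}"

subsection \<open>Toeplitz operators\<close>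

text \<open>A representative of the orthogonal projection, which is determined up to equality almost
  everywhere.\<close>

definition K2_proj ::
  "(complex ^ 'n::{finite,linorder}) set \<Rightarrow> nat \<Rightarrow> nat \<Rightarrow> 'n form \<Rightarrow> 'n form" where
  "K2_proj \<Omega> p q f =
     (SOME g. g \<in> K2_forms \<Omega> p q \<and> (\<forall>h \<in> K2_forms \<Omega> p q. L2_inner \<Omega> (form_diff f g) h = 0))"

definition toeplitz ::
  "(complex ^ 'n::{finite,linorder}) set \<Rightarrow> nat \<Rightarrow> nat \<Rightarrow> (complex ^ 'n::{finite,linorder} \<Rightarrow> complex)
     \<Rightarrow> 'n form \<Rightarrow> 'n form" where
  "toeplitz \<Omega> p q \<phi> f = K2_proj \<Omega> p q (form_mult \<phi> f)"

definition Linf :: "(complex ^ 'n) set \<Rightarrow> (complex ^ 'n \<Rightarrow> complex) set" where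
  "Linf \<Omega> = {\<phi> \<in> borel_measurable (lebesgue_on \<Omega>).
               \<exists>C. AE z in lebesgue_on \<Omega>. cmod (\<phi> z) \<le> C}"

text \<open>Compactness of an operator on the Hilbert space of \<open>\<partial>\<close>-bar closed forms: bounded sequences are
  mapped to sequences with a norm convergent subsequence. The condition does not depend on the choice
  of representatives for the values of \<open>T\<close>.\<close>

definition compact_on_K2 ::
  "(complex ^ 'n::{finite,linorder}) set \<Rightarrow> nat \<Rightarrow> nat \<Rightarrow> ('n form \<Rightarrow> 'n form) \<Rightarrow> bool" where
  "compact_on_K2 \<Omega> p q T \<longleftrightarrow>
     (\<forall>f :: nat \<Rightarrow> 'n form. (\<forall>k. f k \<in> K2_forms \<Omega> p q) \<longrightarrow> (\<exists>C. \<forall>k. L2_norm \<Omega> (f k) \<le> C) \<longrightarrow>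
        (\<exists>r g. strict_mono (r :: nat \<Rightarrow> nat) \<and> g \<in> K2_forms \<Omega> p q \<and>
           (\<lambda>k. L2_norm \<Omega> (form_diff (T (f (r k))) g)) \<longlonglongrightarrow> 0))"

end

theory Submission
  imports Defs
begin

text \<open>Every ball in \<open>\<Omega>\<close> contains the support of a \<open>\<partial>\<close>-bar closed form of norm 1: normalise \<open>\<partial>\<close>-bar of a
  compactly supported function times \<open>dz\<^sub>I \<and> d\<zeta>\<^sub>J\<close>, which is possible as \<open>q \<ge> 1\<close>. Suppose that
  \<open>\<phi>(z\<^sub>0) \<noteq> 0\<close>, and take such forms \<open>f\<^sub>k\<close> supported in pairwise disjoint balls near \<open>z\<^sub>0\<close>. Then
  \<open>\<langle>T f\<^sub>k, f\<^sub>k\<rangle> = \<integral> \<phi> |f\<^sub>k|\<^sup>2\<close> stays away from \<open>0\<close>, while \<open>\<langle>T f\<^sub>l, f\<^sub>k\<rangle> = \<integral> \<phi> f\<^sub>l \<cdot> cnj f\<^sub>k = 0\<close> for \<open>l \<noteq> k\<close>. By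
  Cauchy-Schwarz \<open>T f\<^sub>k - T f\<^sub>l\<close> has norm bounded below, so \<open>T f\<^sub>k\<close> has no convergent subsequence.
  The projection exists because the closed forms are an orthogonal complement in a complete
  space.\<close>

subsection \<open>The Hilbert space of square integrable forms\<close>

text \<open>In degree \<open>q = 0\<close> closed forms have holomorphic coefficients and cannot be
  localised; for \<open>q \<ge> 1\<close> exactness supplies local ones. The operator is never
  computed: test forms are themselves closed, so pairing with them removes the projection, and only
  these pairings enter the compactness argument.

  The obstacle is that closedness is distributional. The primitive is the cube of a truncated
  quadratic, so the local forms are just C^1 and d-bar of d-bar being 0 is proved weakly: one
  integration by parts shows that pairing the \<open>k\<close>-th component with the
  \<open>j\<close>-th conjugate derivative of a test function is symmetric in \<open>j\<close> and
  \<open>k\<close>, while the signs of the wedge products are antisymmetric. The same integrations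
  by parts make each closedness condition an orthogonality condition.

  Forms are functions, not classes, and \<open>K2_proj\<close> is a choice, so the Hilbert space
  facts are derived for the seminorm \<open>L2_norm\<close>, always through the quadratic expansion
  of \<open>f - c g\<close>.\<close>

lemma (in finite_measure) L2_Cauchy_limit:
  fixes h :: "nat \<Rightarrow> 'a \<Rightarrow> complex"
  assumes h [measurable]: "\<And>k. h k \<in> borel_measurable M"
    and int: "\<And>k m. integrable M (\<lambda>x. (cmod (h m x - h k x))\<^sup>2)"
    and le: "\<And>k m. k \<le> m \<Longrightarrow> (\<integral>x. (cmod (h m x - h k x))\<^sup>2 \<partial>M) \<le> (1/4)^k"
  obtains u where "u \<in> borel_measurable M"
    and "\<And>k. integrable M (\<lambda>x. (cmod (h k x - u x))\<^sup>2)"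
    and "\<And>k. (\<integral>x. (cmod (h k x - u x))\<^sup>2 \<partial>M) \<le> (1/4)^k"
proof -
  define C where "C = (1 + measure M (space M)) / 2"
  have C0: "C \<ge> 0" by (simp add: C_def)
  \<comment> \<open>Finite measure lets the L2 bound \<open>(1/4)^k\<close> become an L1 bound of
    order \<open>(1/2)^k\<close>, which is summable; \<open>C\<close> is the constant that the next
    estimate produces.\<close>
  have step: "(\<integral>\<^sup>+x. ennreal (cmod (h (Suc k) x - h k x)) \<partial>M) \<le> ennreal (C * (1/2)^k)" for k
  proof -
    let ?d = "\<lambda>x. cmod (h (Suc k) x - h k x)"
    \<comment> \<open>The weight \<open>2^k\<close> balances the two terms: after integration both
      are of order \<open>(1/2)^k\<close>.\<close>
    have am_gm: "t \<le> (2^k * t\<^sup>2 + (1/2)^k) / 2" for t :: real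
    proof -
      have "0 \<le> 2^k * (t - (1/2)^k)\<^sup>2" by simp
      also have "\<dots> = 2^k * t\<^sup>2 - 2 * (2^k * (1/2)^k) * t + (2^k * (1/2)^k) * (1/2)^k"
        by (simp add: power2_eq_square algebra_simps)
      also have "(2::real)^k * (1/2)^k = 1" by (simp flip: power_mult_distrib)
      finally show ?thesis by simp
    qed
    have I: "integrable M (\<lambda>x. (2^k * (?d x)\<^sup>2 + (1/2)^k) / 2)"
      using int by (intro integrable_divide integrable_add integrable_mult_right) auto
    have "(\<integral>\<^sup>+x. ennreal (?d x) \<partial>M) \<le> (\<integral>\<^sup>+x. ennreal ((2^k * (?d x)\<^sup>2 + (1/2)^k) / 2) \<partial>M)"
      by (intro nn_integral_mono ennreal_leI am_gm)
    also have "\<dots> = ennreal (\<integral>x. (2^k * (?d x)\<^sup>2 + (1/2)^k) / 2 \<partial>M)"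
      by (rule nn_integral_eq_integral[OF I]) simp
    also have "(\<integral>x. (2^k * (?d x)\<^sup>2 + (1/2)^k) / 2 \<partial>M)
        = (2^k * (\<integral>x. (?d x)\<^sup>2 \<partial>M) + (1/2)^k * measure M (space M)) / 2"
      using int by simp
    also have "\<dots> \<le> (2^k * (1/4)^k + (1/2)^k * measure M (space M)) / 2"
      using le[of k "Suc k"] by simp
    also have "(2::real)^k * (1/4)^k = (1/2)^k" by (simp flip: power_mult_distrib)
    also have "((1/2)^k + (1/2)^k * measure M (space M)) / 2 = C * (1/2)^k"
      by (simp add: C_def field_simps)
    finally show ?thesis by (simp add: ennreal_leI)
  qed
  have "(\<integral>\<^sup>+x. (\<Sum>k. ennreal (cmod (h (Suc k) x - h k x))) \<partial>M)
      = (\<Sum>k. \<integral>\<^sup>+x. ennreal (cmod (h (Suc k) x - h k x)) \<partial>M)"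
    by (rule nn_integral_suminf) simp
  also have "\<dots> \<le> (\<Sum>k. ennreal (C * (1/2)^k))"
    by (intro suminf_le step) auto
  also have "\<dots> < \<infinity>"
    using C0 by (subst suminf_ennreal2) (auto intro!: summable_mult summable_geometric)
  finally have "AE x in M. (\<Sum>k. ennreal (cmod (h (Suc k) x - h k x))) \<noteq> \<infinity>"
    by (intro nn_integral_PInf_AE) auto
  \<comment> \<open>The increments are absolutely summable almost everywhere, and their partial sums
    telescope to \<open>h n x\<close>. The prescribed rate thus gives convergence of the whole
    sequence, not just of a subsequence.\<close>
  then have conv: "AE x in M. (\<lambda>k. h k x) \<longlonglongrightarrow> lim (\<lambda>k. h k x)"
  proof eventually_elim
    case (elim x)
    then have "summable (\<lambda>k. cmod (h (Suc k) x - h k x))"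
      by (intro summable_suminf_not_top) auto
    then have "summable (\<lambda>k. h (Suc k) x - h k x)"
      by (rule summable_norm_cancel)
    then have "convergent (\<lambda>n. (\<Sum>k<n. h (Suc k) x - h k x) + h 0 x)"
      by (intro convergent_add convergent_const) (simp add: summable_iff_convergent)
    moreover have "(\<Sum>k<n. h (Suc k) x - h k x) + h 0 x = h n x" for n
      by (subst sum_lessThan_telescope) simp
    ultimately have "convergent (\<lambda>n. h n x)" by simp
    then show ?case by (simp add: convergent_LIMSEQ_iff)
  qed
  define u where "u x = lim (\<lambda>k. h k x)" for x
  have u [measurable]: "u \<in> borel_measurable M"
    unfolding u_def by measurable
  \<comment> \<open>Fatou's lemma in \<open>m\<close> with \<open>k\<close> fixed carries the Cauchy
    bound over to the limit.\<close>
  have bound: "(\<integral>\<^sup>+x. ennreal ((cmod (h k x - u x))\<^sup>2) \<partial>M) \<le> ennreal ((1/4)^k)" for k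
  proof -
    have "(\<integral>\<^sup>+x. ennreal ((cmod (h k x - u x))\<^sup>2) \<partial>M)
        = (\<integral>\<^sup>+x. liminf (\<lambda>m. ennreal ((cmod (h m x - h k x))\<^sup>2)) \<partial>M)"
    proof (rule nn_integral_cong_AE, use conv in eventually_elim)
      case (elim x)
      then have "(\<lambda>m. ennreal ((cmod (h m x - h k x))\<^sup>2)) \<longlonglongrightarrow> ennreal ((cmod (u x - h k x))\<^sup>2)"
        unfolding u_def by (intro tendsto_intros) auto
      from lim_imp_Liminf[OF _ this] show ?case
        by (simp add: norm_minus_commute)
    qed
    also have "\<dots> \<le> liminf (\<lambda>m. \<integral>\<^sup>+x. ennreal ((cmod (h m x - h k x))\<^sup>2) \<partial>M)"
      by (rule nn_integral_liminf) measurable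
    also have "\<dots> \<le> ennreal ((1/4)^k)"
    proof (rule Liminf_le)
      show "\<forall>\<^sub>F m in sequentially. (\<integral>\<^sup>+x. ennreal ((cmod (h m x - h k x))\<^sup>2) \<partial>M) \<le> ennreal ((1/4)^k)"
        using eventually_ge_at_top[of k]
        by eventually_elim (use le int in \<open>auto simp: nn_integral_eq_integral intro!: ennreal_leI\<close>)
    qed simp
    finally show ?thesis .
  qed
  have intu: "integrable M (\<lambda>x. (cmod (h k x - u x))\<^sup>2)" for k
    using bound[of k] by (intro integrableI_bounded) (auto intro: le_less_trans)
  moreover have "(\<integral>x. (cmod (h k x - u x))\<^sup>2 \<partial>M) \<le> (1/4)^k" for k
    using bound[of k] intu[of k] by (simp add: nn_integral_eq_integral)
  ultimately show thesis using that u by blast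
qed

section \<open>Inner product and seminorm on forms\<close>

lemma integrable_L2_mult_cnj:
  fixes f g :: "'a \<Rightarrow> complex"
  assumes [measurable]: "f \<in> borel_measurable M" "g \<in> borel_measurable M"
    and "integrable M (\<lambda>x. (cmod (f x))\<^sup>2)" "integrable M (\<lambda>x. (cmod (g x))\<^sup>2)"
  shows "integrable M (\<lambda>x. f x * cnj (g x))"
proof (rule Bochner_Integration.integrable_bound)
  show "integrable M (\<lambda>x. (cmod (f x))\<^sup>2 + (cmod (g x))\<^sup>2)" using assms by auto
  have "s * t \<le> s\<^sup>2 + t\<^sup>2" if "s \<ge> 0" "t \<ge> 0" for s t :: real
    using sum_squares_bound[of s t] that mult_nonneg_nonneg[OF that] by linarith
  then show "AE x in M. norm (f x * cnj (g x)) \<le> norm ((cmod (f x))\<^sup>2 + (cmod (g x))\<^sup>2)"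
    by (auto simp: norm_mult)
  have "cnj \<in> borel_measurable borel"
    by (intro borel_measurable_continuous_onI continuous_intros)
  then show "(\<lambda>x. f x * cnj (g x)) \<in> borel_measurable M"
    by measurable
qed

lemma cmod_diff_scale_power2:
  "(cmod (a - c * b))\<^sup>2 = (cmod a)\<^sup>2 - 2 * Re (cnj c * (a * cnj b)) + (cmod c)\<^sup>2 * (cmod b)\<^sup>2"
  by (simp only: cmod_power2) (simp add: power2_eq_square algebra_simps)

abbreviation form_scale :: "complex \<Rightarrow> 'n::finite form \<Rightarrow> 'n form" where
  "form_scale c \<equiv> form_mult (\<lambda>_. c)"

lemma L2_formsD:
  assumes "f \<in> L2_forms \<Omega> p q"
  shows "(\<lambda>z. f z I J) \<in> borel_measurable (lebesgue_on \<Omega>)"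
    "integrable (lebesgue_on \<Omega>) (\<lambda>z. (cmod (f z I J))\<^sup>2)"
    "f z I J \<noteq> 0 \<Longrightarrow> card I = p \<and> card J = q"
  using assms by (auto simp: L2_forms_def)

lemma L2_forms_integrable_mult:
  assumes "f \<in> L2_forms \<Omega> p q" "g \<in> L2_forms \<Omega> p q"
  shows "integrable (lebesgue_on \<Omega>) (\<lambda>z. f z I J * cnj (g z I J))"
  using assms by (intro integrable_L2_mult_cnj L2_formsD)

text \<open>The combination \<open>f - c g\<close> serves as the basic linear operation:
  \<open>c = 1\<close> gives differences, \<open>c = -1\<close> sums, and \<open>f = 0\<close>
  scalar multiples.\<close>

lemma L2_forms_diff_scale:
  assumes f: "f \<in> L2_forms \<Omega> p q" and g: "g \<in> L2_forms \<Omega> p q"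
  shows "form_diff f (form_scale c g) \<in> L2_forms \<Omega> p q"
proof -
  have "integrable (lebesgue_on \<Omega>) (\<lambda>z. (cmod (f z I J))\<^sup>2 -
      2 * Re (cnj c * (f z I J * cnj (g z I J))) + (cmod c)\<^sup>2 * (cmod (g z I J))\<^sup>2)" for I J
    using L2_formsD[OF f] L2_formsD[OF g] L2_forms_integrable_mult[OF f g]
    by (intro Bochner_Integration.integrable_add Bochner_Integration.integrable_diff
        integrable_mult_right integrable_Re) auto
  moreover have "(\<lambda>z. f z I J - c * g z I J) \<in> borel_measurable (lebesgue_on \<Omega>)" for I J
    using L2_formsD(1)[OF f] L2_formsD(1)[OF g] by (intro borel_measurable_diff borel_measurable_times) auto
  moreover have "f z I J - c * g z I J \<noteq> 0 \<Longrightarrow> card I = p \<and> card J = q" for z I J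
    using L2_formsD(3)[OF f, of z I J] L2_formsD(3)[OF g, of z I J]
    by (metis diff_zero mult_zero_right)
  ultimately show ?thesis
    unfolding L2_forms_def form_diff_def form_mult_def mem_Collect_eq cmod_diff_scale_power2
    by blast
qed

lemma form_scale_1 [simp]: "form_scale 1 f = f"
  by (simp add: form_mult_def)

lemma L2_forms_diff:
  "f \<in> L2_forms \<Omega> p q \<Longrightarrow> g \<in> L2_forms \<Omega> p q \<Longrightarrow> form_diff f g \<in> L2_forms \<Omega> p q"
  using L2_forms_diff_scale[of f \<Omega> p q g 1] by simp

lemma zero_L2_forms: "(\<lambda>z I J. 0) \<in> L2_forms \<Omega> p q"
  by (simp add: L2_forms_def)

lemma L2_inner_diff_scale:
  assumes f: "f \<in> L2_forms \<Omega> p q" and g: "g \<in> L2_forms \<Omega> p q" and h: "h \<in> L2_forms \<Omega> p q"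
  shows "L2_inner \<Omega> (form_diff f (form_scale c g)) h = L2_inner \<Omega> f h - c * L2_inner \<Omega> g h"
  using L2_forms_integrable_mult[OF f h] L2_forms_integrable_mult[OF g h]
  by (simp add: L2_inner_def form_diff_def form_mult_def left_diff_distrib mult.assoc
      sum_subtractf sum_distrib_left)

lemma L2_inner_diff:
  assumes "f \<in> L2_forms \<Omega> p q" "g \<in> L2_forms \<Omega> p q" "h \<in> L2_forms \<Omega> p q"
  shows "L2_inner \<Omega> (form_diff f g) h = L2_inner \<Omega> f h - L2_inner \<Omega> g h"
  using L2_inner_diff_scale[OF assms, of 1] by simp

lemma L2_norm_power2:
  "(L2_norm \<Omega> f)\<^sup>2 = (\<Sum>I\<in>UNIV. \<Sum>J\<in>UNIV. \<integral>z. (cmod (f z I J))\<^sup>2 \<partial>lebesgue_on \<Omega>)"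
  unfolding L2_norm_def by (intro real_sqrt_pow2 sum_nonneg) auto

lemma L2_norm_nonneg [simp]: "0 \<le> L2_norm \<Omega> f"
  unfolding L2_norm_def by (intro real_sqrt_ge_zero sum_nonneg) auto

lemma L2_inner_self: "L2_inner \<Omega> f f = of_real ((L2_norm \<Omega> f)\<^sup>2)"
  unfolding L2_norm_power2 L2_inner_def
  by (simp flip: complex_norm_square of_real_power integral_complex_of_real)

lemma L2_norm_scale: "L2_norm \<Omega> (form_scale c f) = cmod c * L2_norm \<Omega> f"
  by (simp add: L2_norm_def form_mult_def norm_mult power_mult_distrib real_sqrt_mult
      flip: sum_distrib_left)

lemma L2_norm_diff_scale_power2:
  assumes f: "f \<in> L2_forms \<Omega> p q" and g: "g \<in> L2_forms \<Omega> p q"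
  shows "(L2_norm \<Omega> (form_diff f (form_scale c g)))\<^sup>2
    = (L2_norm \<Omega> f)\<^sup>2 - 2 * Re (cnj c * L2_inner \<Omega> f g) + (cmod c)\<^sup>2 * (L2_norm \<Omega> g)\<^sup>2"
proof -
  have "(\<integral>z. (cmod (f z I J - c * g z I J))\<^sup>2 \<partial>lebesgue_on \<Omega>)
    = (\<integral>z. (cmod (f z I J))\<^sup>2 \<partial>lebesgue_on \<Omega>)
      - 2 * Re (cnj c * (\<integral>z. f z I J * cnj (g z I J) \<partial>lebesgue_on \<Omega>))
      + (cmod c)\<^sup>2 * (\<integral>z. (cmod (g z I J))\<^sup>2 \<partial>lebesgue_on \<Omega>)" for I J
  proof -
    have "integrable (lebesgue_on \<Omega>) (\<lambda>z. cnj c * (f z I J * cnj (g z I J)))"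
      using L2_forms_integrable_mult[OF f g] by auto
    note this [THEN integrable_Re] this [THEN integral_Re]
    then show ?thesis
      using L2_formsD(2)[OF f, of I J] L2_formsD(2)[OF g, of I J]
      unfolding cmod_diff_scale_power2
      by (simp del: times_complex.sel)
  qed
  then show ?thesis
    unfolding L2_norm_power2 form_diff_def form_mult_def L2_inner_def
    by (simp add: sum.distrib sum_subtractf sum_distrib_left del: times_complex.sel)
qed

lemma L2_Cauchy_Schwarz:
  assumes f: "f \<in> L2_forms \<Omega> p q" and g: "g \<in> L2_forms \<Omega> p q"
  shows "cmod (L2_inner \<Omega> f g) \<le> L2_norm \<Omega> f * L2_norm \<Omega> g"
proof -
  define X where "X = (cmod (L2_inner \<Omega> f g))\<^sup>2"
  \<comment> \<open>With \<open>c = s * L2_inner \<Omega> f g\<close> the cross term is real, so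
    nonnegativity of the squared norm of \<open>f - c g\<close> is a real quadratic inequality in
    \<open>s\<close>.\<close>
  have ge: "0 \<le> (L2_norm \<Omega> f)\<^sup>2 - 2 * s * X + s\<^sup>2 * X * (L2_norm \<Omega> g)\<^sup>2" for s :: real
  proof -
    have "Re (cnj (of_real s * L2_inner \<Omega> f g) * L2_inner \<Omega> f g) = s * X"
      unfolding X_def cmod_power2 by (simp add: power2_eq_square algebra_simps)
    then show ?thesis
      using L2_norm_diff_scale_power2[OF f g, of "of_real s * L2_inner \<Omega> f g"]
        zero_le_power2[of "L2_norm \<Omega> (form_diff f (form_scale (of_real s * L2_inner \<Omega> f g) g))"]
      by (simp add: X_def norm_mult power_mult_distrib)
  qed
  have "X \<le> (L2_norm \<Omega> f * L2_norm \<Omega> g)\<^sup>2"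
  proof (cases "L2_norm \<Omega> g = 0")
    case True
    have "X = 0"
    proof (rule ccontr)
      assume "X \<noteq> 0"
      then have "X > 0" by (simp add: X_def)
      \<comment> \<open>The inequality is now linear in \<open>s\<close>, and this \<open>s\<close>
        makes its right-hand side equal to -1.\<close>
      with ge[of "((L2_norm \<Omega> f)\<^sup>2 + 1) / (2 * X)"] True show False by simp
    qed
    then show ?thesis by simp
  next
    case False
    define N where "N = (L2_norm \<Omega> g)\<^sup>2"
    have N: "N > 0" using False by (simp add: N_def)
    \<comment> \<open>\<open>s = 1 / N\<close> minimises the quadratic.\<close>
    have "0 \<le> (L2_norm \<Omega> f)\<^sup>2 - X / N"
      using ge[of "1 / N"] N unfolding N_def[symmetric] by (simp add: power2_eq_square)
    with N show ?thesis
      by (simp add: power_mult_distrib field_simps flip: N_def)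
  qed
  then show ?thesis
    unfolding X_def by (rule power2_le_imp_le) simp
qed

text \<open>First variation: if the pairing were nonzero, subtracting a small positive multiple of
  \<open>L2_inner \<Omega> f g\<close> times \<open>g\<close> would lower the norm of
  \<open>f\<close>.\<close>

lemma L2_orthogonal_if_norm_le:
  assumes f: "f \<in> L2_forms \<Omega> p q" and g: "g \<in> L2_forms \<Omega> p q"
    and le: "\<And>c. L2_norm \<Omega> f \<le> L2_norm \<Omega> (form_diff f (form_scale c g))"
  shows "L2_inner \<Omega> f g = 0"
proof (rule ccontr)
  assume ne: "L2_inner \<Omega> f g \<noteq> 0"
  define X where "X = (cmod (L2_inner \<Omega> f g))\<^sup>2"
  \<comment> \<open>With \<open>N\<close> the squared norm of \<open>g\<close>, the squared norm
    changes by \<open>s * X * (s * N - 2)\<close>. This \<open>s\<close> keeps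
    \<open>s * N \<le> 1\<close> and is also defined when \<open>N = 0\<close>.\<close>
  define s where "s = 1 / (1 + (L2_norm \<Omega> g)\<^sup>2)"
  have X: "X > 0" using ne by (simp add: X_def)
  have s: "s > 0" unfolding s_def by (simp add: add_pos_nonneg)
  have "Re (cnj (of_real s * L2_inner \<Omega> f g) * L2_inner \<Omega> f g) = s * X"
    unfolding X_def cmod_power2 by (simp add: power2_eq_square algebra_simps)
  then have "0 \<le> - 2 * s * X + s\<^sup>2 * X * (L2_norm \<Omega> g)\<^sup>2"
    using L2_norm_diff_scale_power2[OF f g, of "of_real s * L2_inner \<Omega> f g"]
      power_mono[OF le[of "of_real s * L2_inner \<Omega> f g"], of 2]
    by (simp add: X_def norm_mult power_mult_distrib)
  also have "\<dots> = (s * X) * (s * (L2_norm \<Omega> g)\<^sup>2 - 2)"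
    by (simp add: power2_eq_square algebra_simps)
  finally have "s * (L2_norm \<Omega> g)\<^sup>2 \<ge> 2"
    using X s mult_pos_pos[OF s X] by (auto simp: zero_le_mult_iff)
  moreover have "s * (L2_norm \<Omega> g)\<^sup>2 \<le> 1"
    unfolding s_def by (simp add: field_simps add_pos_nonneg)
  ultimately show False by simp
qed

lemma L2_parallelogram:
  assumes f: "f \<in> L2_forms \<Omega> p q" and g: "g \<in> L2_forms \<Omega> p q"
  shows "(L2_norm \<Omega> (form_diff f g))\<^sup>2 + (L2_norm \<Omega> (form_diff f (form_scale (-1) g)))\<^sup>2
    = 2 * (L2_norm \<Omega> f)\<^sup>2 + 2 * (L2_norm \<Omega> g)\<^sup>2"
  using L2_norm_diff_scale_power2[OF f g, of 1] L2_norm_diff_scale_power2[OF f g, of "-1"] by simp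

section \<open>Completeness and orthogonal projection\<close>

lemma finite_measure_lebesgue_on_bounded:
  fixes \<Omega> :: "'a::euclidean_space set"
  assumes "open \<Omega>" "bounded \<Omega>"
  shows "finite_measure (lebesgue_on \<Omega>)"
proof (rule finite_measureI)
  have "\<Omega> \<in> lmeasurable"
    using assms by (simp add: bounded_set_imp_lmeasurable)
  then show "emeasure (lebesgue_on \<Omega>) (space (lebesgue_on \<Omega>)) \<noteq> \<infinity>"
    by (auto simp: emeasure_restrict_space fmeasurable_def)
qed

text \<open>There are finitely many coefficients, so limits are taken coefficientwise. The rate
  \<open>(1/4)^k\<close> costs nothing in the application, where a minimising sequence can be chosen
  to satisfy it.\<close>

lemma L2_forms_complete:
  fixes \<Omega> :: "(complex ^ 'n) set"
  assumes "open \<Omega>" "bounded \<Omega>"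
    and g: "\<And>k. g k \<in> L2_forms \<Omega> p q"
    and le: "\<And>k m. k \<le> m \<Longrightarrow> (L2_norm \<Omega> (form_diff (g m) (g k)))\<^sup>2 \<le> (1/4)^k"
  obtains u where "u \<in> L2_forms \<Omega> p q" "(\<lambda>k. L2_norm \<Omega> (form_diff (g k) u)) \<longlonglongrightarrow> 0"
proof -
  interpret finite_measure "lebesgue_on \<Omega>"
    using assms by (intro finite_measure_lebesgue_on_bounded)
  let ?M = "lebesgue_on \<Omega>"
  define lim_coeff where "lim_coeff I J v \<longleftrightarrow> v \<in> borel_measurable ?M \<and>
      (\<forall>k. integrable ?M (\<lambda>z. (cmod (g k z I J - v z))\<^sup>2)) \<and>
      (\<forall>k. (\<integral>z. (cmod (g k z I J - v z))\<^sup>2 \<partial>?M) \<le> (1/4)^k)" for I J v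
  have "\<exists>v. lim_coeff I J v" for I J
  proof -
    have le_coeff: "(\<integral>z. (cmod (g m z I J - g k z I J))\<^sup>2 \<partial>?M) \<le> (1/4)^k" if "k \<le> m" for k m
    proof -
      have "(\<integral>z. (cmod (g m z I J - g k z I J))\<^sup>2 \<partial>?M)
          \<le> (\<Sum>J\<in>UNIV. \<integral>z. (cmod (g m z I J - g k z I J))\<^sup>2 \<partial>?M)"
        by (rule member_le_sum[of J UNIV "\<lambda>J. \<integral>z. (cmod (g m z I J - g k z I J))\<^sup>2 \<partial>?M"]) auto
      also have "\<dots> \<le> (\<Sum>I\<in>UNIV. \<Sum>J\<in>UNIV. \<integral>z. (cmod (g m z I J - g k z I J))\<^sup>2 \<partial>?M)"
        by (rule member_le_sum[of I UNIV "\<lambda>I. \<Sum>J\<in>UNIV. \<integral>z. (cmod (g m z I J - g k z I J))\<^sup>2 \<partial>?M"])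
          (auto intro: sum_nonneg)
      also have "\<dots> \<le> (1/4)^k"
        using le[OF that] by (simp add: L2_norm_power2 form_diff_def)
      finally show ?thesis .
    qed
    have int: "integrable ?M (\<lambda>z. (cmod (g m z I J - g k z I J))\<^sup>2)" for k m
      using L2_formsD(2)[OF L2_forms_diff[OF g g]] by (simp add: form_diff_def)
    show ?thesis
    proof (rule L2_Cauchy_limit[of "\<lambda>k z. g k z I J", OF L2_formsD(1)[OF g] int le_coeff])
      fix v
      assume "v \<in> borel_measurable ?M" "\<And>k. integrable ?M (\<lambda>z. (cmod (g k z I J - v z))\<^sup>2)"
        "\<And>k. (\<integral>z. (cmod (g k z I J - v z))\<^sup>2 \<partial>?M) \<le> (1/4)^k"
      then show ?thesis unfolding lim_coeff_def by (intro exI[of _ v] conjI allI)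
    qed
  qed
  then obtain v where "lim_coeff I J (v I J)" for I J by metis
  then have v: "v I J \<in> borel_measurable ?M"
    "integrable ?M (\<lambda>z. (cmod (g k z I J - v I J z))\<^sup>2)"
    "(\<integral>z. (cmod (g k z I J - v I J z))\<^sup>2 \<partial>?M) \<le> (1/4)^k" for I J k
    unfolding lim_coeff_def by simp_all
  \<comment> \<open>For index sets of the wrong size \<open>v I J\<close> vanishes only almost
    everywhere on \<open>\<Omega>\<close>, whereas \<open>L2_forms\<close> demands zero at every
    point; hence the truncation.\<close>
  define u where "u z I J = (if card I = p \<and> card J = q then v I J z else 0)" for z I J
  have g0: "g k z I J = 0" if "\<not> (card I = p \<and> card J = q)" for k z I J
    using L2_formsD(3)[OF g] that by blast
  have dif: "form_diff (g k) u = (\<lambda>z I J. if card I = p \<and> card J = q then g k z I J - v I J z else 0)" for k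
    using g0 by (auto simp: form_diff_def u_def fun_eq_iff)
  have meas: "(\<lambda>z. g k z I J - v I J z) \<in> borel_measurable ?M" for k I J
    using L2_formsD(1)[OF g] v(1) by (rule borel_measurable_diff)
  have d: "form_diff (g k) u \<in> L2_forms \<Omega> p q" for k
  proof -
    have "integrable ?M (\<lambda>z. (cmod (if card I = p \<and> card J = q then g k z I J - v I J z else 0))\<^sup>2)" for I J
      using v(2) by (cases "card I = p"; cases "card J = q") simp_all
    then show ?thesis
      unfolding dif L2_forms_def using meas by (auto split: if_splits)
  qed
  have "u = form_diff (g 0) (form_diff (g 0) u)"
    by (simp add: form_diff_def)
  then have u: "u \<in> L2_forms \<Omega> p q"
    using L2_forms_diff[OF g d] by metis
  have "(L2_norm \<Omega> (form_diff (g k) u))\<^sup>2 \<le> (\<Sum>I\<in>(UNIV::'n set set). \<Sum>J\<in>(UNIV::'n set set). (1/4)^k)" for k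
    unfolding L2_norm_power2 dif
  proof (intro sum_mono)
    fix I J
    show "(\<integral>z. (cmod (if card I = p \<and> card J = q then g k z I J - v I J z else 0))\<^sup>2 \<partial>?M) \<le> (1/4)^k"
      using v(3) by (cases "card I = p"; cases "card J = q") simp_all
  qed
  then have bound: "(L2_norm \<Omega> (form_diff (g k) u))\<^sup>2 \<le> (real CARD('n set))\<^sup>2 * (1/4)^k" for k
    by (simp add: power2_eq_square mult.assoc)
  have "(\<lambda>k. (real CARD('n set))\<^sup>2 * (1/4::real)^k) \<longlonglongrightarrow> (real CARD('n set))\<^sup>2 * 0"
    by (intro tendsto_intros LIMSEQ_power_zero) auto
  then have geometric: "(\<lambda>k. (real CARD('n set))\<^sup>2 * (1/4::real)^k) \<longlonglongrightarrow> 0"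
    by (simp only: mult_zero_right)
  have "(\<lambda>k. (L2_norm \<Omega> (form_diff (g k) u))\<^sup>2) \<longlonglongrightarrow> 0"
    by (rule tendsto_sandwich[OF _ _ tendsto_const geometric])
      (intro always_eventually allI bound zero_le_power2)+
  from tendsto_real_sqrt[OF this] have "(\<lambda>k. L2_norm \<Omega> (form_diff (g k) u)) \<longlonglongrightarrow> 0"
    by simp
  then show thesis using that u by blast
qed

text \<open>The minimal distance argument. That \<open>K\<close> is defined by orthogonality to
  \<open>S\<close> makes it stable under limits, by Cauchy-Schwarz.\<close>

lemma ex_projection_orthogonal_complement:
  fixes \<Omega> :: "(complex ^ 'n) set"
  assumes \<Omega>: "open \<Omega>" "bounded \<Omega>" and S: "S \<subseteq> L2_forms \<Omega> p q"
    and K: "K = {f \<in> L2_forms \<Omega> p q. \<forall>h\<in>S. L2_inner \<Omega> f h = 0}"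
    and f: "f \<in> L2_forms \<Omega> p q"
  shows "\<exists>g\<in>K. \<forall>h\<in>K. L2_inner \<Omega> (form_diff f g) h = 0"
proof -
  have KL: "g \<in> L2_forms \<Omega> p q" if "g \<in> K" for g using that K by auto
  have comb: "form_diff g (form_scale c h) \<in> K" if "g \<in> K" "h \<in> K" for g h c
  proof -
    have "L2_inner \<Omega> (form_diff g (form_scale c h)) s = 0" if "s \<in> S" for s
      using L2_inner_diff_scale[of g \<Omega> p q h s c] that S \<open>g \<in> K\<close> \<open>h \<in> K\<close> K by auto
    then show ?thesis using L2_forms_diff_scale[of g \<Omega> p q h c] that K by auto
  qed
  have zero: "(\<lambda>z I J. 0) \<in> K"
    using K zero_L2_forms by (auto simp: L2_inner_def)
  define D where "D g = (L2_norm \<Omega> (form_diff f g))\<^sup>2" for g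
  define d where "d = (INF g\<in>K. D g)"
  have bdd: "bdd_below (D ` K)"
    by (rule bdd_belowI[of _ 0]) (auto simp: D_def)
  have d_le: "d \<le> D g" if "g \<in> K" for g
    unfolding d_def using bdd that by (rule cINF_lower)
  \<comment> \<open>The margin is chosen for the parallelogram law, which bounds the squared
    distance of \<open>g m\<close> and \<open>g k\<close> by
    \<open>2 * D (g k) + 2 * D (g m) - 4 * d\<close>, hence by \<open>(1/4)^k\<close> when
    \<open>k \<le> m\<close>.\<close>
  have "\<exists>g\<in>K. D g < d + (1/4)^k / 4" for k
  proof -
    have "(INF g\<in>K. D g) < d + (1/4)^k / 4" by (simp add: d_def)
    then show ?thesis using bdd zero by (subst (asm) cINF_less_iff) auto
  qed
  then obtain g where gK: "\<And>k. g k \<in> K" and gd: "\<And>k. D (g k) < d + (1/4)^k / 4"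
    by metis
  note gL = KL[OF gK]
  have cauchy: "(L2_norm \<Omega> (form_diff (g m) (g k)))\<^sup>2 \<le> (1/4)^k" if "k \<le> m" for k m
  proof -
    define x y where "x = form_diff f (g k)" and "y = form_diff f (g m)"
    \<comment> \<open>The midpoint of \<open>g k\<close> and \<open>g m\<close>, written with
      differences so that \<open>comb\<close> applies.\<close>
    define mid where "mid = form_diff (form_scale (1/2) (g k)) (form_scale (-1/2) (g m))"
    have "form_scale (1/2) (g k) = form_diff (\<lambda>z I J. 0) (form_scale (-1/2) (g k))"
      by (simp add: form_diff_def form_mult_def)
    then have midK: "mid \<in> K"
      unfolding mid_def using comb[OF _ gK] comb[OF zero gK] by metis
    have eq1: "form_diff x y = form_diff (g m) (g k)"
      by (simp add: x_def y_def form_diff_def)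
    have eq2: "form_diff x (form_scale (-1) y) = form_scale 2 (form_diff f mid)"
      by (simp add: x_def y_def form_diff_def mid_def form_mult_def fun_eq_iff field_simps)
    have "(L2_norm \<Omega> (form_diff (g m) (g k)))\<^sup>2 + 4 * D mid = 2 * D (g k) + 2 * D (g m)"
      using L2_parallelogram[of x \<Omega> p q y, OF _ _] L2_forms_diff[OF f gL]
      unfolding eq1 eq2 L2_norm_scale D_def by (simp add: x_def y_def power_mult_distrib)
    moreover have "(1/4::real)^m \<le> (1/4)^k"
      using that by (intro power_decreasing) auto
    ultimately show ?thesis
      using d_le[OF midK] gd[of k] gd[of m] by linarith
  qed
  obtain u where u: "u \<in> L2_forms \<Omega> p q" and lim: "(\<lambda>k. L2_norm \<Omega> (form_diff (g k) u)) \<longlonglongrightarrow> 0"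
    using L2_forms_complete[OF \<Omega> gL cauchy] by blast
  have "L2_inner \<Omega> u h = 0" if "h \<in> S" for h
  proof -
    have hL: "h \<in> L2_forms \<Omega> p q" using that S by auto
    have le: "cmod (L2_inner \<Omega> u h) \<le> L2_norm \<Omega> (form_diff (g k) u) * L2_norm \<Omega> h" for k
      using L2_Cauchy_Schwarz[OF L2_forms_diff[OF gL u] hL, of k]
        L2_inner_diff[OF gL u hL, of k] gK[of k] that K by auto
    have "(\<lambda>k. L2_norm \<Omega> (form_diff (g k) u) * L2_norm \<Omega> h) \<longlonglongrightarrow> 0"
      using tendsto_mult_left_zero[OF lim] .
    from LIMSEQ_le_const[OF this, of "cmod (L2_inner \<Omega> u h)"] le show ?thesis by auto
  qed
  then have uK: "u \<in> K" using u K by auto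
  have Du: "L2_norm \<Omega> (form_diff f u) \<le> L2_norm \<Omega> (form_diff f v)" if "v \<in> K" for v
  proof -
    let ?e = "form_diff f u"
    have eL: "?e \<in> L2_forms \<Omega> p q" using L2_forms_diff[OF f u] .
    \<comment> \<open>Expanding \<open>D (g k)\<close> around \<open>f - u\<close> and applying
      Cauchy-Schwarz to the cross term shows that the limit \<open>u\<close> attains the
      infimum.\<close>
    have "(L2_norm \<Omega> ?e)\<^sup>2 \<le> d"
    proof (rule LIMSEQ_le_const)
      let ?\<delta> = "\<lambda>k. L2_norm \<Omega> (form_diff (g k) u)"
      show "(\<lambda>k. d + (1/4)^k / 4 + 2 * (?\<delta> k * L2_norm \<Omega> ?e)) \<longlonglongrightarrow> d"
        using lim by (auto intro!: tendsto_eq_intros LIMSEQ_power_zero)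
      have "(L2_norm \<Omega> ?e)\<^sup>2 \<le> d + (1/4)^k / 4 + 2 * (?\<delta> k * L2_norm \<Omega> ?e)" for k
      proof -
        have dL: "form_diff (g k) u \<in> L2_forms \<Omega> p q" using L2_forms_diff[OF gL u] .
        have "form_diff f (g k) = form_diff ?e (form_scale 1 (form_diff (g k) u))"
          by (simp add: form_diff_def)
        then have "D (g k) = (L2_norm \<Omega> ?e)\<^sup>2 - 2 * Re (L2_inner \<Omega> ?e (form_diff (g k) u)) + (?\<delta> k)\<^sup>2"
          unfolding D_def using L2_norm_diff_scale_power2[OF eL dL, of 1] by simp
        moreover have "Re (L2_inner \<Omega> ?e (form_diff (g k) u)) \<le> ?\<delta> k * L2_norm \<Omega> ?e"
          using L2_Cauchy_Schwarz[OF eL dL] complex_Re_le_cmod[of "L2_inner \<Omega> ?e (form_diff (g k) u)"]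
          by (simp add: mult.commute)
        moreover have "0 \<le> (?\<delta> k)\<^sup>2" by simp
        ultimately show ?thesis using gd[of k] by linarith
      qed
      then show "\<exists>N. \<forall>k\<ge>N. (L2_norm \<Omega> ?e)\<^sup>2 \<le> d + (1/4)^k / 4 + 2 * (?\<delta> k * L2_norm \<Omega> ?e)"
        by blast
    qed
    with d_le[OF that] show ?thesis
      unfolding D_def by (meson L2_norm_nonneg order_trans power2_le_imp_le)
  qed
  have "L2_inner \<Omega> (form_diff f u) h = 0" if "h \<in> K" for h
  proof (rule L2_orthogonal_if_norm_le)
    show "form_diff f u \<in> L2_forms \<Omega> p q" using L2_forms_diff[OF f u] .
    show "h \<in> L2_forms \<Omega> p q" using KL that .
    fix c
    have "form_diff (form_diff f u) (form_scale c h) = form_diff f (form_diff u (form_scale (-c) h))"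
      by (simp add: form_diff_def form_mult_def fun_eq_iff)
    then show "L2_norm \<Omega> (form_diff f u) \<le> L2_norm \<Omega> (form_diff (form_diff f u) (form_scale c h))"
      using Du[OF comb[OF uK that]] by simp
  qed
  then show ?thesis using uK by blast
qed

subsection \<open>Integration by parts for a radial vector field\<close>

text \<open>By translation invariance of Lebesgue measure every difference quotient of
  \<open>F\<close> has integral 0, and the quotients converge to the derivative under a common
  integrable bound.\<close>

lemma integral_directional_derivative_eq_0:
  fixes F :: "'a::euclidean_space \<Rightarrow> complex"
  assumes F: "\<And>z. (F has_derivative D z) (at z)"
    and D: "continuous_on UNIV (\<lambda>z. D z v)"
    and K: "compact K" "\<And>z. z \<notin> K \<Longrightarrow> F z = 0"
  shows "(\<integral>z. D z v \<partial>lebesgue) = 0"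
proof -
  have Fc: "continuous_on UNIV F"
    using F by (meson continuous_at_imp_continuous_on has_derivative_continuous)
  have Fm [measurable]: "F \<in> borel_measurable borel"
    using Fc by (rule borel_measurable_continuous_onI)
  have Dm: "(\<lambda>z. D z v) \<in> borel_measurable borel"
    using D by (rule borel_measurable_continuous_onI)
  have D0: "D z v = 0" if "z \<notin> K" for z
  proof -
    have "(F has_derivative (\<lambda>_. 0)) (at z)"
      by (rule has_derivative_transform_within_open[of "\<lambda>_. 0" _ _ _ "- K"])
        (use K that compact_imp_closed in auto)
    with F[of z] have "D z = (\<lambda>_. 0)" by (rule has_derivative_unique)
    then show ?thesis by simp
  qed
  obtain R where R: "R > 0" "K \<subseteq> ball 0 R"
    using K compact_imp_bounded bounded_subset_ballD by blast
  have "bounded ((\<lambda>z. D z v) ` K)"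
    using D K by (intro compact_imp_bounded compact_continuous_image) (auto intro: continuous_on_subset)
  then obtain B where B: "B > 0" "\<And>z. z \<in> K \<Longrightarrow> norm (D z v) \<le> B"
    by (auto simp: bounded_pos)
  have DB: "norm (D z v) \<le> B" for z
    using B D0[of z] by (cases "z \<in> K") auto
  \<comment> \<open>The mean value inequality along the line through \<open>z\<close> in direction
    \<open>v\<close> bounds all difference quotients by \<open>B\<close>.\<close>
  have lip: "norm (F (z + t *\<^sub>R v) - F z) \<le> B * t" if "t \<ge> 0" for z t
  proof -
    have "((\<lambda>s. F (z + s *\<^sub>R v)) has_derivative (\<lambda>h. D (z + s *\<^sub>R v) (h *\<^sub>R v))) (at s within UNIV)" for s
      by (rule has_derivative_compose[of "\<lambda>s. z + s *\<^sub>R v" "\<lambda>h. h *\<^sub>R v" s UNIV F, OF _ F])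
        (auto intro!: derivative_eq_intros)
    moreover have "onorm (\<lambda>h. D (z + s *\<^sub>R v) (h *\<^sub>R v)) \<le> B" for s
    proof (rule onorm_le)
      fix h :: real
      have "D (z + s *\<^sub>R v) (h *\<^sub>R v) = h *\<^sub>R D (z + s *\<^sub>R v) v"
        using F[of "z + s *\<^sub>R v"] by (simp add: linear_simps has_derivative_bounded_linear)
      then show "norm (D (z + s *\<^sub>R v) (h *\<^sub>R v)) \<le> B * norm h"
        using DB[of "z + s *\<^sub>R v"] by (simp add: mult.commute[of B] mult_left_mono)
    qed
    ultimately have "norm (F (z + t *\<^sub>R v) - F (z + 0 *\<^sub>R v)) \<le> B * norm (t - 0)"
      by (intro differentiable_bound[of UNIV "\<lambda>s. F (z + s *\<^sub>R v)"
          "\<lambda>s h. D (z + s *\<^sub>R v) (h *\<^sub>R v)"]) auto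
    then show ?thesis using that by simp
  qed
  define s where "s n z = real (Suc n) *\<^sub>R (F (z + inverse (real (Suc n)) *\<^sub>R v) - F z)" for n z
  have "(\<lambda>n. \<integral>z. s n z \<partial>lborel) \<longlonglongrightarrow> (\<integral>z. D z v \<partial>lborel)"
  \<comment> \<open>The steps \<open>inverse (real (Suc n))\<close> are at most 1, so all quotients
    vanish outside the ball enlarged by \<open>norm v\<close>.\<close>
  proof (rule integral_dominated_convergence[where w="\<lambda>z. B * indicator (cball 0 (R + norm v)) z"])
    show "integrable lborel (\<lambda>z. B * indicator (cball (0::'a) (R + norm v)) z)"
      by (intro integrable_mult_right integrable_real_indicator) (auto intro!: emeasure_bounded_finite[unfolded infinity_ennreal_def])
    show "s n \<in> borel_measurable lborel" for n
      unfolding s_def by measurable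
    show "(\<lambda>z. D z v) \<in> borel_measurable lborel" using Dm by simp
    show "AE z in lborel. (\<lambda>n. s n z) \<longlonglongrightarrow> D z v"
    proof (rule AE_I2)
      fix z
      have "((\<lambda>t. F (z + t *\<^sub>R v)) has_derivative (\<lambda>h. D z (h *\<^sub>R v))) (at (0::real))"
        by (rule has_derivative_compose[of "\<lambda>s. z + s *\<^sub>R v" "\<lambda>h. h *\<^sub>R v" 0 UNIV F])
          (use F[of z] in \<open>auto intro!: derivative_eq_intros\<close>)
      moreover have "D z (h *\<^sub>R v) = h *\<^sub>R D z v" for h
        using F[of z] by (simp add: linear_simps has_derivative_bounded_linear)
      ultimately have "((\<lambda>t. F (z + t *\<^sub>R v)) has_vector_derivative D z v) (at 0)"
        by (simp add: has_vector_derivative_def)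
      then have "((\<lambda>t. norm (F (z + t *\<^sub>R v) - F z - t *\<^sub>R D z v) / norm t) \<longlongrightarrow> 0) (at 0)"
        by (simp add: has_vector_derivative_def has_derivative_at)
      moreover have "\<forall>\<^sub>F t in at 0. norm (F (z + t *\<^sub>R v) - F z - t *\<^sub>R D z v) / norm t
          = norm ((F (z + t *\<^sub>R v) - F z) /\<^sub>R t - D z v)"
        unfolding eventually_at_topological
      proof (intro exI[of _ UNIV] conjI ballI impI)
        fix t :: real assume "t \<noteq> 0"
        then have "(F (z + t *\<^sub>R v) - F z) /\<^sub>R t - D z v = (F (z + t *\<^sub>R v) - F z - t *\<^sub>R D z v) /\<^sub>R t"
          by (simp add: scaleR_diff_right)
        then show "norm (F (z + t *\<^sub>R v) - F z - t *\<^sub>R D z v) / norm t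
          = norm ((F (z + t *\<^sub>R v) - F z) /\<^sub>R t - D z v)"
          by (simp add: divide_inverse mult.commute)
      qed auto
      ultimately have "((\<lambda>t. norm ((F (z + t *\<^sub>R v) - F z) /\<^sub>R t - D z v)) \<longlongrightarrow> 0) (at 0)"
        by (rule Lim_transform_eventually)
      then have lim: "((\<lambda>t. (F (z + t *\<^sub>R v) - F z) /\<^sub>R t) \<longlongrightarrow> D z v) (at 0)"
        by (rule Lim_null[THEN iffD2, OF tendsto_norm_zero_cancel])
      have "filterlim (\<lambda>n. inverse (real (Suc n))) (at 0) sequentially"
        unfolding filterlim_at
        by (intro conjI LIMSEQ_inverse_real_of_nat always_eventually allI) simp_all
      from filterlim_compose[OF lim this] show "(\<lambda>n. s n z) \<longlonglongrightarrow> D z v"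
        by (simp only: s_def inverse_inverse_eq)
    qed
    show "AE z in lborel. norm (s n z) \<le> B * indicator (cball 0 (R + norm v)) z" for n
    proof (rule AE_I2)
      fix z
      show "norm (s n z) \<le> B * indicator (cball 0 (R + norm v)) z"
      proof (cases "z \<in> cball 0 (R + norm v)")
        case True
        have "norm (s n z) = real (Suc n) * norm (F (z + inverse (real (Suc n)) *\<^sub>R v) - F z)"
          by (simp add: s_def)
        also have "\<dots> \<le> real (Suc n) * (B * inverse (real (Suc n)))"
          by (intro mult_left_mono lip) auto
        also have "\<dots> = B" by (simp add: field_simps)
        finally show ?thesis using True by simp
      next
        case False
        then have "R + norm v < norm z" by simp
        moreover have "norm z \<le> norm (z + inverse (real (Suc n)) *\<^sub>R v) + norm (inverse (real (Suc n)) *\<^sub>R v)"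
          by (metis add_diff_cancel_right' norm_triangle_ineq4)
        moreover have "norm (inverse (real (Suc n)) *\<^sub>R v) \<le> norm v"
          by (simp add: inverse_le_1_iff mult_left_le_one_le)
        ultimately have "R < norm z" "R < norm (z + inverse (real (Suc n)) *\<^sub>R v)"
          using norm_ge_zero[of v] by linarith+
        then have "z \<notin> K" "z + inverse (real (Suc n)) *\<^sub>R v \<notin> K" using R by auto
        then show ?thesis using False K by (simp add: s_def)
      qed
    qed
  qed
  moreover have "(\<integral>z. s n z \<partial>lborel) = 0" for n
  proof -
    have "integrable lborel (\<lambda>z. indicator K z *\<^sub>R F z)"
      using Fc K by (intro borel_integrable_compact) (auto intro: continuous_on_subset)
    then have int: "integrable lborel F"
      by (rule Bochner_Integration.integrable_cong[THEN iffD1, rotated -1])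
        (use K in \<open>auto simp: indicator_def\<close>)
    define c where "c = inverse (real (Suc n)) *\<^sub>R v"
    have int': "integrable lborel (\<lambda>z. F (c + z))"
      by (rule integrable_distr[of "(+) c" lborel borel]) (auto simp: lborel_distr_plus int)
    have "(\<integral>z. F z \<partial>lborel) = (\<integral>z. F (c + z) \<partial>lborel)"
      by (subst lborel_distr_plus[of c, symmetric]) (rule integral_distr, auto)
    then show ?thesis
      unfolding s_def c_def[symmetric] using int int' by (simp add: add.commute)
  qed
  ultimately have "(\<lambda>n. 0) \<longlonglongrightarrow> (\<integral>z. D z v \<partial>lborel)"
    by (simp only:)
  then have "(\<integral>z. D z v \<partial>lborel) = 0"
    by (rule LIMSEQ_unique[OF _ tendsto_const])
  then show ?thesis
    using Dm by (simp add: integral_completion)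
qed

section \<open>The radial field and the symmetry of its conjugate derivatives\<close>

lemma has_real_derivative_pos_part_power2:
  "((\<lambda>x::real. (max 0 x)\<^sup>2) has_real_derivative 2 * max 0 x) (at x)"
proof -
  consider "x > 0" | "x < 0" | "x = 0" by linarith
  then show ?thesis
  proof cases
    case 1
    have "((\<lambda>x::real. x\<^sup>2) has_real_derivative 2 * max 0 x) (at x)"
      using 1 by (auto intro!: derivative_eq_intros)
    then show ?thesis
      by (rule has_field_derivative_transform_within_open[of _ _ _ "{0<..}"]) (use 1 in auto)
  next
    case 2
    have "((\<lambda>x::real. 0) has_real_derivative 2 * max 0 x) (at x)"
      using 2 by (auto intro!: derivative_eq_intros)
    then show ?thesis
      by (rule has_field_derivative_transform_within_open[of _ _ _ "{..<0}"]) (use 2 in auto)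
  next
    case 3
    \<comment> \<open>At the kink the square makes the difference quotient at most
      \<open>\<bar>y\<bar>\<close> in modulus.\<close>
    have "((\<lambda>y. (max 0 (y::real))\<^sup>2 / y) \<longlongrightarrow> 0) (at 0)"
    proof (rule Lim_null_comparison)
      show "\<forall>\<^sub>F y in at 0. norm ((max 0 (y::real))\<^sup>2 / y) \<le> \<bar>y\<bar>"
        by (rule always_eventually) (auto simp: max_def power2_eq_square)
      show "((\<lambda>y::real. \<bar>y\<bar>) \<longlongrightarrow> 0) (at 0)"
        by (auto intro!: tendsto_eq_intros)
    qed
    then show ?thesis using 3 by (simp add: has_field_derivative_iff)
  qed
qed

text \<open>This is \<open>-1/3\<close> times the derivative of \<open>(max 0 (\<epsilon>\<^sup>2 - |z - a|\<^sup>2))\<^sup>3\<close> with respect to the conjugate of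
  \<open>z\<^sub>k\<close>; the square instead of a smooth cutoff already gives a continuously differentiable function.\<close>

definition radial_field :: "complex ^ 'n \<Rightarrow> real \<Rightarrow> 'n \<Rightarrow> complex ^ 'n \<Rightarrow> complex" where
  "radial_field a \<epsilon> k z = of_real ((max 0 (\<epsilon>\<^sup>2 - (z - a) \<bullet> (z - a)))\<^sup>2) * (z $ k - a $ k)"

text \<open>The product rule written out: an explicit formula from which continuity of the
  derivative can be read off.\<close>

definition radial_field_deriv :: "complex ^ 'n \<Rightarrow> real \<Rightarrow> 'n \<Rightarrow> complex ^ 'n \<Rightarrow> complex ^ 'n \<Rightarrow> complex" where
  "radial_field_deriv a \<epsilon> k z v =
     of_real (- 4 * max 0 (\<epsilon>\<^sup>2 - (z - a) \<bullet> (z - a)) * ((z - a) \<bullet> v)) * (z $ k - a $ k)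
     + of_real ((max 0 (\<epsilon>\<^sup>2 - (z - a) \<bullet> (z - a)))\<^sup>2) * v $ k"

lemma has_derivative_radial_field:
  "(radial_field a \<epsilon> k has_derivative radial_field_deriv a \<epsilon> k z) (at z)"
proof -
  have "((\<lambda>z. \<epsilon>\<^sup>2 - (z - a) \<bullet> (z - a)) has_derivative (\<lambda>v. - 2 * ((z - a) \<bullet> v))) (at z)"
    by (auto intro!: derivative_eq_intros simp: inner_commute)
  from has_derivative_compose[OF this
      has_real_derivative_pos_part_power2[unfolded has_field_derivative_def]]
  have 1: "((\<lambda>z. (max 0 (\<epsilon>\<^sup>2 - (z - a) \<bullet> (z - a)))\<^sup>2) has_derivative
      (\<lambda>v. - 4 * max 0 (\<epsilon>\<^sup>2 - (z - a) \<bullet> (z - a)) * ((z - a) \<bullet> v))) (at z)"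
    by (simp add: mult.assoc)
  have 2: "((\<lambda>z. z $ k - a $ k) has_derivative (\<lambda>v. v $ k)) (at z)"
    by (auto intro!: derivative_eq_intros bounded_linear.has_derivative[OF bounded_linear_vec_nth])
  show ?thesis
    unfolding radial_field_def [abs_def] radial_field_deriv_def [abs_def]
    using has_derivative_mult[OF has_derivative_of_real[OF 1] 2]
    by (simp add: algebra_simps)
qed

lemma continuous_on_radial_field: "continuous_on S (radial_field a \<epsilon> k)"
  unfolding radial_field_def [abs_def] by (intro continuous_intros)

lemma radial_field_eq_0: "z \<notin> ball a \<epsilon> \<Longrightarrow> 0 \<le> \<epsilon> \<Longrightarrow> radial_field a \<epsilon> k z = 0"
proof -
  assume "z \<notin> ball a \<epsilon>" "0 \<le> \<epsilon>"
  then have "\<epsilon>\<^sup>2 \<le> (norm (z - a))\<^sup>2"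
    by (intro power_mono) (auto simp: dist_norm norm_minus_commute)
  then show ?thesis by (simp add: radial_field_def flip: power2_norm_eq_inner)
qed

text \<open>Twice the conjugate derivative. The term with \<open>v $ k\<close> cancels because
  coordinates are holomorphic, and the conjugate derivative of the squared distance is
  \<open>z $ j - a $ j\<close>. The result is symmetric in \<open>j\<close> and \<open>k\<close>, as
  befits second derivatives of one potential.\<close>

lemma dbar_radial_field:
  "radial_field_deriv a \<epsilon> k z (axis j 1) + \<i> * radial_field_deriv a \<epsilon> k z (axis j \<i>)
   = of_real (- 4 * max 0 (\<epsilon>\<^sup>2 - (z - a) \<bullet> (z - a))) * ((z $ j - a $ j) * (z $ k - a $ k))"
proof -
  have "complex_of_real ((z - a) \<bullet> axis j 1) + \<i> * of_real ((z - a) \<bullet> axis j \<i>) = z $ j - a $ j"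
    by (simp add: inner_axis complex_eq_iff)
  then have *: "c * complex_of_real ((z - a) \<bullet> axis j 1) + \<i> * (c * of_real ((z - a) \<bullet> axis j \<i>))
      = c * (z $ j - a $ j)" for c
    by (metis distrib_left mult.left_commute)
  have "axis j (1::complex) $ k + \<i> * axis j \<i> $ k = 0"
    by (simp add: axis_def)
  then have **: "c * axis j (1::complex) $ k + \<i> * (c * axis j \<i> $ k) = 0" for c
    by (metis distrib_left mult.left_commute mult_zero_right)
  show ?thesis
    using *[of "of_real (- 4 * max 0 (\<epsilon>\<^sup>2 - (z - a) \<bullet> (z - a))) * (z $ k - a $ k)"]
      **[of "of_real ((max 0 (\<epsilon>\<^sup>2 - (z - a) \<bullet> (z - a)))\<^sup>2)"]
    unfolding radial_field_deriv_def of_real_mult by (simp add: algebra_simps)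
qed

lemma test_functionsD:
  assumes "\<psi> \<in> test_functions \<Omega>"
  shows "(\<psi> has_derivative frechet_derivative \<psi> (at z)) (at z)"
    and "continuous_on UNIV (\<lambda>z. frechet_derivative \<psi> (at z) v)"
    and "continuous_on UNIV \<psi>"
proof -
  have "Ck (Suc 0) \<psi>" using assms by (auto simp: test_functions_def)
  then have d: "\<And>z. \<psi> differentiable (at z)" and "continuous_on UNIV (\<lambda>z. frechet_derivative \<psi> (at z) v)"
    by auto
  then show "(\<psi> has_derivative frechet_derivative \<psi> (at z)) (at z)"
    "continuous_on UNIV (\<lambda>z. frechet_derivative \<psi> (at z) v)"
    using frechet_derivative_works by blast+
  show "continuous_on UNIV \<psi>"
    using d by (simp add: continuous_at_imp_continuous_on differentiable_imp_continuous_within)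
qed

lemma continuous_on_dbar_partial:
  assumes "\<psi> \<in> test_functions \<Omega>"
  shows "continuous_on UNIV (dbar_partial j \<psi>)"
  unfolding dbar_partial_def [abs_def] by (intro continuous_intros test_functionsD[OF assms]) auto

text \<open>Weak form of the commutation of conjugate derivatives. Integration by parts moves the
  derivative from \<open>\<psi>\<close> to the field, where the symmetry is visible. The boundary
  term vanishes because the field does outside the ball.\<close>

lemma radial_field_dbar_symmetric:
  fixes \<Omega> :: "(complex ^ 'n) set"
  assumes \<Omega>: "open \<Omega>" "cball a \<epsilon> \<subseteq> \<Omega>" and \<epsilon>: "0 < \<epsilon>" and \<psi>: "\<psi> \<in> test_functions \<Omega>"
  shows "(\<integral>z. radial_field a \<epsilon> k z * dbar_partial j \<psi> z \<partial>lebesgue_on \<Omega>)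
       = (\<integral>z. radial_field a \<epsilon> j z * dbar_partial k \<psi> z \<partial>lebesgue_on \<Omega>)"
proof -
  let ?\<psi>' = "\<lambda>z. frechet_derivative \<psi> (at z)"
  \<comment> \<open>The \<open>j\<close>-th conjugate derivative of the \<open>k\<close>-th field,
    times \<open>\<psi>\<close>; the factor -2 is half of the -4 in
    \<open>dbar_radial_field\<close>.\<close>
  define H where "H k j z =
    of_real (- 2 * max 0 (\<epsilon>\<^sup>2 - (z - a) \<bullet> (z - a))) * ((z $ j - a $ j) * (z $ k - a $ k)) * \<psi> z" for k j z
  have out: "radial_field a \<epsilon> k z = 0" if "z \<notin> cball a \<epsilon>" for k z
    using that \<epsilon> by (intro radial_field_eq_0) auto
  have supp: "integrable lebesgue u" if "continuous_on UNIV u" "\<And>z. z \<notin> cball a \<epsilon> \<Longrightarrow> u z = 0"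
    for u :: "complex ^ 'n \<Rightarrow> complex"
  proof -
    have "integrable lborel (\<lambda>z. indicator (cball a \<epsilon>) z *\<^sub>R u z)"
      using that by (intro borel_integrable_compact) (auto intro: continuous_on_subset)
    also have "(\<lambda>z. indicator (cball a \<epsilon>) z *\<^sub>R u z) = u"
      using that(2) by (auto simp: indicator_def fun_eq_iff)
    finally show ?thesis
      using that(1) by (simp add: integrable_completion borel_measurable_continuous_onI)
  qed
  have key: "(\<integral>z. radial_field a \<epsilon> k z * dbar_partial j \<psi> z \<partial>lebesgue) = - (\<integral>z. H k j z \<partial>lebesgue)" for k j
  proof -
    define D where "D z v = radial_field a \<epsilon> k z * ?\<psi>' z v + radial_field_deriv a \<epsilon> k z v * \<psi> z" for z v
    have der: "((\<lambda>z. radial_field a \<epsilon> k z * \<psi> z) has_derivative D z) (at z)" for z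
      unfolding D_def [abs_def] by (intro has_derivative_mult has_derivative_radial_field test_functionsD[OF \<psi>])
    have cont: "continuous_on UNIV (\<lambda>z. D z v)" for v
      unfolding D_def radial_field_deriv_def
      by (intro continuous_intros continuous_on_radial_field test_functionsD[OF \<psi>])
    have zero: "(\<integral>z. D z v \<partial>lebesgue) = 0" for v
      using integral_directional_derivative_eq_0[OF der cont compact_cball[of a \<epsilon>]] out by auto
    have D0: "D z v = 0" if "z \<notin> cball a \<epsilon>" for z v
    proof -
      have "((\<lambda>z. radial_field a \<epsilon> k z * \<psi> z) has_derivative (\<lambda>_. 0)) (at z)"
        by (rule has_derivative_transform_within_open[of "\<lambda>_. 0" _ _ _ "- cball a \<epsilon>"])
          (use that out in auto)
      with der[of z] have "D z = (\<lambda>_. 0)" by (rule has_derivative_unique)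
      then show ?thesis by simp
    qed
    have intD: "integrable lebesgue (\<lambda>z. D z v)" for v
      using cont D0 by (intro supp)
    have H0: "H k j z = 0" if "z \<notin> cball a \<epsilon>" for z
    proof -
      have "\<epsilon>\<^sup>2 \<le> (norm (z - a))\<^sup>2"
        using that \<epsilon> by (intro power_mono) (auto simp: dist_norm norm_minus_commute)
      then show ?thesis by (simp add: H_def flip: power2_norm_eq_inner)
    qed
    have intH: "integrable lebesgue (H k j)"
      using H0 unfolding H_def by (intro supp continuous_intros test_functionsD[OF \<psi>])
    have "radial_field a \<epsilon> k z * dbar_partial j \<psi> z = (D z (axis j 1) + \<i> * D z (axis j \<i>)) / 2 - H k j z" for z
    proof -
      have "D z (axis j 1) + \<i> * D z (axis j \<i>) = 2 * (radial_field a \<epsilon> k z * dbar_partial j \<psi> z)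
        + (radial_field_deriv a \<epsilon> k z (axis j 1) + \<i> * radial_field_deriv a \<epsilon> k z (axis j \<i>)) * \<psi> z"
        by (simp add: D_def dbar_partial_def algebra_simps)
      also have "\<dots> = 2 * (radial_field a \<epsilon> k z * dbar_partial j \<psi> z) + 2 * H k j z"
        unfolding dbar_radial_field H_def by simp
      finally show ?thesis by (simp add: field_simps)
    qed
    then show ?thesis
      using intD intH zero by simp
  qed
  have restrict: "(\<integral>z. radial_field a \<epsilon> k z * u z \<partial>lebesgue_on \<Omega>) = (\<integral>z. radial_field a \<epsilon> k z * u z \<partial>lebesgue)" for k u
  proof -
    have "(\<integral>z. radial_field a \<epsilon> k z * u z \<partial>lebesgue_on \<Omega>)
        = (\<integral>z. indicator \<Omega> z *\<^sub>R (radial_field a \<epsilon> k z * u z) \<partial>lebesgue)"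
      using \<Omega> by (intro integral_restrict_space) auto
    also have "(\<lambda>z. indicator \<Omega> z *\<^sub>R (radial_field a \<epsilon> k z * u z)) = (\<lambda>z. radial_field a \<epsilon> k z * u z)"
      using out \<Omega> by (force simp: indicator_def fun_eq_iff)
    finally show ?thesis .
  qed
  have "H k j = H j k" by (simp add: H_def fun_eq_iff)
  then show ?thesis by (simp add: restrict key)
qed

lemma continuous_L2_on_bounded:
  fixes u :: "'a::euclidean_space \<Rightarrow> complex"
  assumes \<Omega>: "open \<Omega>" "bounded \<Omega>" and u: "continuous_on UNIV u"
  shows "u \<in> borel_measurable (lebesgue_on \<Omega>)"
    and "integrable (lebesgue_on \<Omega>) (\<lambda>z. (cmod (u z))\<^sup>2)"
proof -
  interpret finite_measure "lebesgue_on \<Omega>"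
    using \<Omega> by (rule finite_measure_lebesgue_on_bounded)
  show m [measurable]: "u \<in> borel_measurable (lebesgue_on \<Omega>)"
    using \<Omega> u by (intro continuous_imp_measurable_on_sets_lebesgue) (auto intro: continuous_on_subset)
  have "bounded (u ` closure \<Omega>)"
    using \<Omega> u by (intro compact_imp_bounded compact_continuous_image)
      (auto intro: continuous_on_subset simp: compact_closure)
  then obtain B where "\<And>z. z \<in> closure \<Omega> \<Longrightarrow> cmod (u z) \<le> B"
    by (auto simp: bounded_iff)
  then have "cmod (u z) \<le> B" if "z \<in> \<Omega>" for z
    using that closure_subset by blast
  then show "integrable (lebesgue_on \<Omega>) (\<lambda>z. (cmod (u z))\<^sup>2)"
    by (intro integrable_const_bound[where B="B\<^sup>2"] AE_I2) (auto intro!: power_mono)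
qed

lemma continuous_on_if_const:
  "(b \<Longrightarrow> continuous_on S f) \<Longrightarrow> (\<not> b \<Longrightarrow> continuous_on S g) \<Longrightarrow> continuous_on S (\<lambda>x. if b then f x else g x)"
  by (cases b) simp_all

lemma continuous_L2_forms:
  assumes "open \<Omega>" "bounded \<Omega>" "\<And>I J. continuous_on UNIV (\<lambda>z. f z I J)"
    and "\<And>z I J. f z I J \<noteq> 0 \<Longrightarrow> card I = p \<and> card J = q"
  shows "f \<in> L2_forms \<Omega> p q"
  using assms continuous_L2_on_bounded[OF assms(1,2)] by (auto simp: L2_forms_def)

subsection \<open>The closed forms and Toeplitz operators\<close>

abbreviation insertion_sign :: "'n::{finite,linorder} set \<Rightarrow> 'n \<Rightarrow> complex" where
  "insertion_sign M j \<equiv> (-1) ^ card {k\<in>M. k < j}"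

text \<open>The formal adjoint of d-bar applied to the form with coefficient
  \<open>cnj \<psi>\<close> at \<open>I\<close>, \<open>M\<close>. The outer \<open>cnj\<close>
  compensates the conjugation of the second argument of \<open>L2_inner\<close>.\<close>

definition dbar_dual :: "nat \<Rightarrow> 'n::{finite,linorder} set \<Rightarrow> 'n set \<Rightarrow> (complex ^ 'n::{finite,linorder} \<Rightarrow> complex) \<Rightarrow> 'n form" where
  "dbar_dual p I M \<psi> z I' J' = (if I' = I then \<Sum>j\<in>M. if J' = M - {j}
     then cnj (- ((-1) ^ p * (insertion_sign M j * dbar_partial j \<psi> z))) else 0 else 0)"

lemma dbar_dual_L2_forms:
  assumes "open \<Omega>" "bounded \<Omega>" "\<psi> \<in> test_functions \<Omega>" "card I = p" "card M = q + 1"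
  shows "dbar_dual p I M \<psi> \<in> L2_forms \<Omega> p q"
proof (rule continuous_L2_forms)
  show "continuous_on UNIV (\<lambda>z. dbar_dual p I M \<psi> z I' J')" for I' J'
    unfolding dbar_dual_def
    by (intro continuous_on_if_const continuous_on_sum continuous_on_const continuous_on_cnj
        continuous_on_minus continuous_on_mult_left continuous_on_dbar_partial[OF assms(3)])
  show "card I' = p \<and> card J' = q" if "dbar_dual p I M \<psi> z I' J' \<noteq> 0" for z I' J'
  proof -
    have "\<exists>j\<in>M. J' = M - {j}"
    proof (rule ccontr)
      assume "\<not> (\<exists>j\<in>M. J' = M - {j})"
      then have "dbar_dual p I M \<psi> z I' J' = 0" by (simp add: dbar_dual_def sum.neutral)
      with that show False ..
    qed
    then show ?thesis
      using that assms by (auto simp: dbar_dual_def split: if_splits)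
  qed
qed (use assms in auto)

lemma weak_dbar_eq_L2_inner:
  fixes \<Omega> :: "(complex ^ 'n::{finite,linorder}) set"
  assumes \<Omega>: "open \<Omega>" "bounded \<Omega>" and \<psi>: "\<psi> \<in> test_functions \<Omega>" and f: "f \<in> L2_forms \<Omega> p q"
  shows "weak_dbar \<Omega> p f I M \<psi> = L2_inner \<Omega> f (dbar_dual p I M \<psi>)"
proof -
  let ?M = "lebesgue_on \<Omega>"
  let ?c = "\<lambda>j. - ((-1) ^ p * insertion_sign M j)"
  let ?A = "\<lambda>j. \<integral>z. f z I (M - {j}) * dbar_partial j \<psi> z \<partial>?M"
  have int: "integrable ?M (\<lambda>z. f z I (M - {j}) * dbar_partial j \<psi> z)" for j
  proof -
    have "continuous_on UNIV (\<lambda>z. cnj (dbar_partial j \<psi> z))"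
      by (intro continuous_intros continuous_on_dbar_partial[OF \<psi>])
    from continuous_L2_on_bounded[OF \<Omega> this]
    show ?thesis
      using integrable_L2_mult_cnj[OF L2_formsD(1)[OF f] _ L2_formsD(2)[OF f],
          of "\<lambda>z. cnj (dbar_partial j \<psi> z)" I "M - {j}"] by simp
  qed
  have coeff: "(\<integral>z. f z I' J' * cnj (dbar_dual p I M \<psi> z I' J') \<partial>?M)
      = (if I' = I then \<Sum>j\<in>M. if J' = M - {j} then ?c j * ?A j else 0 else 0)" for I' J'
  proof (cases "I' = I")
    case True
    have "f z I' J' * cnj (dbar_dual p I M \<psi> z I' J')
      = (\<Sum>j\<in>M. if J' = M - {j} then ?c j * (f z I (M - {j}) * dbar_partial j \<psi> z) else 0)" for z
      unfolding dbar_dual_def True by (auto simp: sum_distrib_left intro!: sum.cong)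
    moreover have "integrable ?M (\<lambda>z. if J' = M - {j} then ?c j * (f z I (M - {j}) * dbar_partial j \<psi> z) else 0)" for j
      using int[of j] by (cases "J' = M - {j}") auto
    ultimately have "(\<integral>z. f z I' J' * cnj (dbar_dual p I M \<psi> z I' J') \<partial>?M)
      = (\<Sum>j\<in>M. \<integral>z. (if J' = M - {j} then ?c j * (f z I (M - {j}) * dbar_partial j \<psi> z) else 0) \<partial>?M)"
      by (simp add: Bochner_Integration.integral_sum)
    also have "\<dots> = (\<Sum>j\<in>M. if J' = M - {j} then ?c j * ?A j else 0)"
    proof (rule sum.cong)
      fix j show "(\<integral>z. (if J' = M - {j} then ?c j * (f z I (M - {j}) * dbar_partial j \<psi> z) else 0) \<partial>?M)
        = (if J' = M - {j} then ?c j * ?A j else 0)"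
        by (cases "J' = M - {j}") simp_all
    qed simp
    finally show ?thesis using True by simp
  qed (simp add: dbar_dual_def)
  have "L2_inner \<Omega> f (dbar_dual p I M \<psi>)
      = (\<Sum>I'\<in>UNIV. if I' = I then \<Sum>J'\<in>UNIV. \<Sum>j\<in>M. if J' = M - {j} then ?c j * ?A j else 0 else 0)"
    unfolding L2_inner_def coeff
  proof (intro sum.cong refl)
    fix I'
    show "(\<Sum>J'\<in>UNIV. if I' = I then \<Sum>j\<in>M. if J' = M - {j} then ?c j * ?A j else 0 else 0)
        = (if I' = I then \<Sum>J'\<in>UNIV. \<Sum>j\<in>M. if J' = M - {j} then ?c j * ?A j else 0 else 0)"
      by (cases "I' = I") (simp_all only: if_True if_False simp_thms sum.neutral_const)
  qed
  also have "\<dots> = (\<Sum>J'\<in>UNIV. \<Sum>j\<in>M. if J' = M - {j} then ?c j * ?A j else 0)"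
    by simp
  \<comment> \<open>After the swap each \<open>j\<close> selects exactly one \<open>J'\<close>, so
    the inner sum collapses.\<close>
  also have "\<dots> = (\<Sum>j\<in>M. \<Sum>J'\<in>UNIV. if J' = M - {j} then ?c j * ?A j else 0)"
    by (rule sum.swap)
  also have "\<dots> = (\<Sum>j\<in>M. ?c j * ?A j)" by simp
  finally show ?thesis
    by (simp add: weak_dbar_def sum_distrib_left mult.assoc sum_negf)
qed

text \<open>Puts the closed forms into the shape that the projection lemma requires, with the forms
  \<open>dbar_dual\<close> as the set \<open>S\<close>.\<close>

lemma K2_forms_eq_orthogonal_complement:
  fixes \<Omega> :: "(complex ^ 'n::{finite,linorder}) set"
  assumes \<Omega>: "open \<Omega>" "bounded \<Omega>"
  obtains S where "S \<subseteq> L2_forms \<Omega> p q"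
    and "K2_forms \<Omega> p q = {f \<in> L2_forms \<Omega> p q. \<forall>h\<in>S. L2_inner \<Omega> f h = 0}"
proof
  let ?S = "{dbar_dual p I M \<psi> | I M \<psi>. card I = p \<and> card M = q + 1 \<and> \<psi> \<in> test_functions \<Omega>}"
  show "?S \<subseteq> L2_forms \<Omega> p q"
    using dbar_dual_L2_forms[OF \<Omega>] by auto
  show "K2_forms \<Omega> p q = {f \<in> L2_forms \<Omega> p q. \<forall>h\<in>?S. L2_inner \<Omega> f h = 0}"
    unfolding K2_forms_def using weak_dbar_eq_L2_inner[OF \<Omega>] by fastforce
qed

lemma K2_forms_scale:
  fixes \<Omega> :: "(complex ^ 'n::{finite,linorder}) set"
  assumes \<Omega>: "open \<Omega>" "bounded \<Omega>" and f: "f \<in> K2_forms \<Omega> p q"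
  shows "form_scale c f \<in> K2_forms \<Omega> p q"
proof (rule K2_forms_eq_orthogonal_complement[OF \<Omega>, of p q])
  fix S assume S: "S \<subseteq> L2_forms \<Omega> p q"
    "K2_forms \<Omega> p q = {f \<in> L2_forms \<Omega> p q. \<forall>h\<in>S. L2_inner \<Omega> f h = 0}"
  have fL: "f \<in> L2_forms \<Omega> p q" using f by (simp add: K2_forms_def)
  have scale: "form_scale c f = form_diff (\<lambda>z I J. 0) (form_scale (- c) f)"
    by (simp add: form_diff_def form_mult_def)
  have "L2_inner \<Omega> (form_scale c f) h = 0" if "h \<in> S" for h
  proof -
    have "h \<in> L2_forms \<Omega> p q" using S(1) that by blast
    moreover have "L2_inner \<Omega> (\<lambda>z I J. 0) h = 0" by (simp add: L2_inner_def)
    moreover have "L2_inner \<Omega> f h = 0" using f S(2) that by blast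
    ultimately show ?thesis
      unfolding scale by (subst L2_inner_diff_scale[OF zero_L2_forms fL]) simp_all
  qed
  moreover have "form_scale c f \<in> L2_forms \<Omega> p q"
    unfolding scale using L2_forms_diff_scale[OF zero_L2_forms fL] .
  ultimately show ?thesis unfolding S(2) by blast
qed

lemma form_mult_L2_forms:
  assumes \<phi>: "\<phi> \<in> Linf \<Omega>" and f: "f \<in> L2_forms \<Omega> p q"
  shows "form_mult \<phi> f \<in> L2_forms \<Omega> p q"
proof -
  let ?M = "lebesgue_on \<Omega>"
  obtain C where [measurable]: "\<phi> \<in> borel_measurable ?M" and C: "AE z in ?M. cmod (\<phi> z) \<le> C"
    using \<phi> by (auto simp: Linf_def)
  have m [measurable]: "(\<lambda>z. f z I J) \<in> borel_measurable ?M" for I J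
    using L2_formsD(1)[OF f] .
  have "integrable ?M (\<lambda>z. (cmod (\<phi> z * f z I J))\<^sup>2)" for I J
  proof (rule Bochner_Integration.integrable_bound)
    show "integrable ?M (\<lambda>z. C\<^sup>2 * (cmod (f z I J))\<^sup>2)"
      using L2_formsD(2)[OF f] by auto
    show "AE z in ?M. norm ((cmod (\<phi> z * f z I J))\<^sup>2) \<le> norm (C\<^sup>2 * (cmod (f z I J))\<^sup>2)"
      using C by eventually_elim (auto simp: norm_mult power_mult_distrib intro!: mult_right_mono power_mono)
  qed measurable
  moreover have "card I = p \<and> card J = q" if "\<phi> z * f z I J \<noteq> 0" for z I J
    using L2_formsD(3)[OF f, of z I J] that by fastforce
  ultimately show ?thesis
    unfolding L2_forms_def form_mult_def by auto
qed

text \<open>The two properties that determine the value up to seminorm 0. They hold for the choice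
  made by \<open>K2_proj\<close> once some projection exists.\<close>

lemma toeplitz_spec:
  fixes \<Omega> :: "(complex ^ 'n::{finite,linorder}) set"
  assumes \<Omega>: "open \<Omega>" "bounded \<Omega>" and \<phi>: "\<phi> \<in> Linf \<Omega>" and f: "f \<in> K2_forms \<Omega> p q"
  shows "toeplitz \<Omega> p q \<phi> f \<in> K2_forms \<Omega> p q"
    and "h \<in> K2_forms \<Omega> p q \<Longrightarrow> L2_inner \<Omega> (toeplitz \<Omega> p q \<phi> f) h = L2_inner \<Omega> (form_mult \<phi> f) h"
proof -
  have KL: "g \<in> L2_forms \<Omega> p q" if "g \<in> K2_forms \<Omega> p q" for g
    using that by (simp add: K2_forms_def)
  note mL = form_mult_L2_forms[OF \<phi> KL[OF f]]
  have "\<exists>g. g \<in> K2_forms \<Omega> p q \<and> (\<forall>h\<in>K2_forms \<Omega> p q. L2_inner \<Omega> (form_diff (form_mult \<phi> f) g) h = 0)"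
  proof (rule K2_forms_eq_orthogonal_complement[OF \<Omega>, of p q])
    fix S assume "S \<subseteq> L2_forms \<Omega> p q"
      "K2_forms \<Omega> p q = {f \<in> L2_forms \<Omega> p q. \<forall>h\<in>S. L2_inner \<Omega> f h = 0}"
    from ex_projection_orthogonal_complement[OF \<Omega> this mL] show ?thesis by blast
  qed
  from someI_ex[OF this]
  have T: "toeplitz \<Omega> p q \<phi> f \<in> K2_forms \<Omega> p q"
    "\<And>h. h \<in> K2_forms \<Omega> p q \<Longrightarrow> L2_inner \<Omega> (form_diff (form_mult \<phi> f) (toeplitz \<Omega> p q \<phi> f)) h = 0"
    unfolding toeplitz_def K2_proj_def by auto
  show "toeplitz \<Omega> p q \<phi> f \<in> K2_forms \<Omega> p q" by (rule T)
  show "L2_inner \<Omega> (toeplitz \<Omega> p q \<phi> f) h = L2_inner \<Omega> (form_mult \<phi> f) h" if "h \<in> K2_forms \<Omega> p q"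
    using T(2)[OF that] L2_inner_diff[OF mL KL[OF T(1)] KL[OF that]] by simp
qed

subsection \<open>Closed forms supported in a ball\<close>

text \<open>The anticommutation of one-forms: removing the smaller index first lowers the position
  of the larger by one, whereas removing the larger leaves that of the smaller unchanged.\<close>

lemma insertion_sign_remove:
  fixes M :: "'n::{finite,linorder} set"
  assumes "j \<in> M" "k \<in> M" "j \<noteq> k"
  shows "insertion_sign M j * insertion_sign (M - {j}) k = - (insertion_sign M k * insertion_sign (M - {k}) j)"
proof -
  have *: "insertion_sign M j * insertion_sign (M - {j}) k = - (insertion_sign M k * insertion_sign (M - {k}) j)"
    if "j \<in> M" "k \<in> M" "j < k" for j k
  proof -
    have "{l \<in> M - {k}. l < j} = {l \<in> M. l < j}" using that by auto
    moreover have "card {l \<in> M. l < k} = Suc (card {l \<in> M - {j}. l < k})"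
    proof -
      have "{l \<in> M. l < k} = insert j {l \<in> M - {j}. l < k}" using that by auto
      then show ?thesis by simp
    qed
    ultimately show ?thesis by simp
  qed
  show ?thesis
    using *[of j k] *[of k j] assms by (cases "j < k") auto
qed

lemma sum_antisymmetric_eq_0:
  fixes c :: "'b \<Rightarrow> 'b \<Rightarrow> complex"
  assumes "finite M" and "\<And>j k. j \<in> M \<Longrightarrow> k \<in> M \<Longrightarrow> j \<noteq> k \<Longrightarrow> c j k = - c k j"
  shows "(\<Sum>j\<in>M. \<Sum>k\<in>M - {j}. c j k) = 0"
proof -
  \<comment> \<open>Extension by 0 to the diagonal gives a rectangular index set, on which the two
    sums can be swapped.\<close>
  define d where "d j k = (if k = j then 0 else c j k)" for j k
  have anti: "d j k = - d k j" if "j \<in> M" "k \<in> M" for j k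
    using assms(2)[OF that] by (cases "j = k") (simp_all add: d_def)
  have "(\<Sum>j\<in>M. \<Sum>k\<in>M - {j}. c j k) = (\<Sum>j\<in>M. \<Sum>k\<in>M. d j k)"
    using assms(1) by (intro sum.cong sum.mono_neutral_cong_left) (auto simp: d_def)
  also have "(\<Sum>j\<in>M. \<Sum>k\<in>M. d j k) = 0"
  proof -
    have "(\<Sum>j\<in>M. \<Sum>k\<in>M. d j k) = (\<Sum>k\<in>M. \<Sum>j\<in>M. d j k)" by (rule sum.swap)
    also have "\<dots> = (\<Sum>k\<in>M. \<Sum>j\<in>M. - d k j)"
      by (intro sum.cong refl anti)
    also have "\<dots> = - (\<Sum>j\<in>M. \<Sum>k\<in>M. d j k)" by (simp add: sum_negf)
    finally have "(\<Sum>j\<in>M. \<Sum>k\<in>M. d j k) + (\<Sum>j\<in>M. \<Sum>k\<in>M. d j k) = 0"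
      by (rule eq_neg_iff_add_eq_0[THEN iffD1])
    then show ?thesis by (simp flip: mult_2)
  qed
  finally show ?thesis .
qed

text \<open>Up to a constant this is \<open>\<partial>\<close>-bar of the form with the single coefficient
  \<open>(max 0 (\<epsilon>\<^sup>2 - |z - a|\<^sup>2))\<^sup>3\<close> at \<open>dz\<^sub>I \<and> d\<zeta>\<^sub>J\<close>, where \<open>I = I\<^sub>0\<close> and \<open>J = J\<^sub>0\<close>.\<close>

definition bump_form :: "complex ^ 'n::{finite,linorder} \<Rightarrow> real \<Rightarrow> 'n set \<Rightarrow> 'n set \<Rightarrow> 'n form" where
  "bump_form a \<epsilon> I\<^sub>0 J\<^sub>0 z I J = (if I = I\<^sub>0 then \<Sum>j\<in>J. if J - {j} = J\<^sub>0
     then insertion_sign J j * radial_field a \<epsilon> j z else 0 else 0)"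

lemma bump_form_eq_0: "z \<notin> ball a \<epsilon> \<Longrightarrow> 0 \<le> \<epsilon> \<Longrightarrow> bump_form a \<epsilon> I\<^sub>0 J\<^sub>0 z I J = 0"
  by (simp add: bump_form_def radial_field_eq_0 sum.neutral)

lemma bump_form_L2_forms:
  assumes "open \<Omega>" "bounded \<Omega>" "card I\<^sub>0 = p" "card J\<^sub>0 + 1 = q"
  shows "bump_form a \<epsilon> I\<^sub>0 J\<^sub>0 \<in> L2_forms \<Omega> p q"
proof (rule continuous_L2_forms)
  show "continuous_on UNIV (\<lambda>z. bump_form a \<epsilon> I\<^sub>0 J\<^sub>0 z I J)" for I J
    unfolding bump_form_def
    by (intro continuous_on_if_const continuous_on_sum continuous_on_const
        continuous_on_mult_left continuous_on_radial_field)
  show "card I = p \<and> card J = q" if "bump_form a \<epsilon> I\<^sub>0 J\<^sub>0 z I J \<noteq> 0" for z I J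
  proof -
    have "\<exists>j\<in>J. J - {j} = J\<^sub>0"
    proof (rule ccontr)
      assume "\<not> (\<exists>j\<in>J. J - {j} = J\<^sub>0)"
      then have "bump_form a \<epsilon> I\<^sub>0 J\<^sub>0 z I J = 0" by (simp add: bump_form_def sum.neutral)
      with that show False ..
    qed
    then obtain j where "j \<in> J" "J - {j} = J\<^sub>0" by blast
    then have "card J = q" using assms by (metis Suc_eq_plus1 card_Suc_Diff1 finite)
    then show ?thesis
      using that assms by (auto simp: bump_form_def split: if_splits)
  qed
qed (use assms in auto)

text \<open>Weak version of d-bar composed with d-bar being 0: symmetric integrals meet
  antisymmetric signs.\<close>

lemma bump_form_K2_forms:
  fixes \<Omega> :: "(complex ^ 'n::{finite,linorder}) set"
  assumes \<Omega>: "open \<Omega>" "bounded \<Omega>" and card: "card I\<^sub>0 = p" "card J\<^sub>0 + 1 = q"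
    and a: "cball a \<epsilon> \<subseteq> \<Omega>" "0 < \<epsilon>"
  shows "bump_form a \<epsilon> I\<^sub>0 J\<^sub>0 \<in> K2_forms \<Omega> p q"
proof -
  have "weak_dbar \<Omega> p (bump_form a \<epsilon> I\<^sub>0 J\<^sub>0) I M \<psi> = 0" if \<psi>: "\<psi> \<in> test_functions \<Omega>" for I M \<psi>
  proof (cases "I = I\<^sub>0")
    case True
    let ?M = "lebesgue_on \<Omega>"
    define A where "A k j = (\<integral>z. radial_field a \<epsilon> k z * dbar_partial j \<psi> z \<partial>?M)" for k j
    have A: "A k j = A j k" for k j
      unfolding A_def using radial_field_dbar_symmetric[OF \<Omega>(1) a \<psi>] .
    have int: "integrable ?M (\<lambda>z. radial_field a \<epsilon> k z * dbar_partial j \<psi> z)" for k j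
    proof -
      have "continuous_on UNIV (\<lambda>z. cnj (dbar_partial j \<psi> z))"
        by (intro continuous_intros continuous_on_dbar_partial[OF \<psi>])
      note 1 = continuous_L2_on_bounded[OF \<Omega> this]
      note 2 = continuous_L2_on_bounded[OF \<Omega> continuous_on_radial_field[of UNIV a \<epsilon> k]]
      show ?thesis using integrable_L2_mult_cnj[OF 2(1) 1(1) 2(2) 1(2)] by simp
    qed
    \<comment> \<open>\<open>j\<close> is the index removed by \<open>weak_dbar\<close>,
      \<open>k\<close> the one removed by \<open>bump_form\<close>; the condition on
      \<open>J\<^sub>0\<close> is symmetric in both.\<close>
    define c where "c j k = (if M - {j} - {k} = J\<^sub>0
      then insertion_sign M j * insertion_sign (M - {j}) k * A k j else 0)" for j k
    have "insertion_sign M j * (\<integral>z. bump_form a \<epsilon> I\<^sub>0 J\<^sub>0 z I (M - {j}) * dbar_partial j \<psi> z \<partial>?M)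
      = (\<Sum>k\<in>M - {j}. c j k)" for j
    proof -
      let ?g = "\<lambda>k z. if M - {j} - {k} = J\<^sub>0
        then insertion_sign (M - {j}) k * (radial_field a \<epsilon> k z * dbar_partial j \<psi> z) else 0"
      have "bump_form a \<epsilon> I\<^sub>0 J\<^sub>0 z I (M - {j}) * dbar_partial j \<psi> z = (\<Sum>k\<in>M - {j}. ?g k z)" for z
        unfolding bump_form_def if_P[OF True] sum_distrib_right
        by (intro sum.cong refl) (simp only: mult.assoc mult_zero_left split: if_split, simp)
      moreover have "integrable ?M (?g k)" for k
        using int[of k j] by (cases "M - {j} - {k} = J\<^sub>0") auto
      ultimately have "(\<integral>z. bump_form a \<epsilon> I\<^sub>0 J\<^sub>0 z I (M - {j}) * dbar_partial j \<psi> z \<partial>?M)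
          = (\<Sum>k\<in>M - {j}. \<integral>z. ?g k z \<partial>?M)"
        by (simp add: Bochner_Integration.integral_sum)
      moreover have "insertion_sign M j * (\<integral>z. ?g k z \<partial>?M) = c j k" for k
        by (cases "M - {j} - {k} = J\<^sub>0") (simp_all add: c_def A_def mult.assoc)
      ultimately show ?thesis by (simp add: sum_distrib_left)
    qed
    moreover have "(\<Sum>j\<in>M. \<Sum>k\<in>M - {j}. c j k) = 0"
    proof (rule sum_antisymmetric_eq_0)
      fix j k assume jk: "j \<in> M" "k \<in> M" "j \<noteq> k"
      have comm: "M - {j} - {k} = M - {k} - {j}" by blast
      show "c j k = - c k j"
        unfolding c_def comm insertion_sign_remove[OF jk] A[of k j] by simp
    qed simp
    ultimately show ?thesis by (simp add: weak_dbar_def)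
  qed (simp add: weak_dbar_def bump_form_def)
  then show ?thesis
    unfolding K2_forms_def using bump_form_L2_forms[OF \<Omega> card] by auto
qed

text \<open>The coefficient at \<open>J\<close> is \<open>radial_field a \<epsilon> j\<close> up to
  sign, and a continuous function that is nonzero somewhere is nonzero on an open set, which is not
  negligible.\<close>

lemma L2_norm_bump_form_pos:
  fixes \<Omega> :: "(complex ^ 'n::{finite,linorder}) set"
  assumes \<Omega>: "open \<Omega>" "bounded \<Omega>" and J: "j \<in> J" and a: "cball a \<epsilon> \<subseteq> \<Omega>" "0 < \<epsilon>"
  shows "0 < L2_norm \<Omega> (bump_form a \<epsilon> I (J - {j}))"
proof (rule ccontr)
  let ?M = "lebesgue_on \<Omega>" and ?f = "bump_form a \<epsilon> I (J - {j})"
  assume "\<not> 0 < L2_norm \<Omega> ?f"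
  then have "(L2_norm \<Omega> ?f)\<^sup>2 = 0" using L2_norm_nonneg[of \<Omega> ?f] by simp
  then have "(\<integral>z. (cmod (?f z I J))\<^sup>2 \<partial>?M) = 0"
    unfolding L2_norm_power2 by (auto simp: sum_nonneg_eq_0_iff sum_nonneg)
  moreover have "cmod (?f z I J) = cmod (radial_field a \<epsilon> j z)" for z
  proof -
    have "J - {k} = J - {j} \<longleftrightarrow> k = j" if "k \<in> J" for k using that J by auto
    then have "?f z I J = (\<Sum>k\<in>J. if k = j then insertion_sign J k * radial_field a \<epsilon> k z else 0)"
      unfolding bump_form_def by (auto intro!: sum.cong)
    then show ?thesis using J by (simp add: norm_mult norm_power)
  qed
  ultimately have "(\<integral>z. (cmod (radial_field a \<epsilon> j z))\<^sup>2 \<partial>?M) = 0" by simp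
  then have "AE z in ?M. (cmod (radial_field a \<epsilon> j z))\<^sup>2 = 0"
    using continuous_L2_on_bounded(2)[OF \<Omega> continuous_on_radial_field]
    by (subst (asm) integral_nonneg_eq_0_iff_AE) auto
  then have "AE z in lebesgue. z \<in> \<Omega> \<longrightarrow> radial_field a \<epsilon> j z = 0"
    using \<Omega> by (subst (asm) AE_restrict_space_iff) auto
  then have "AE z in lebesgue. z \<notin> {z. radial_field a \<epsilon> j z \<noteq> 0}"
  proof eventually_elim
    case (elim z)
    have "z \<in> ball a \<epsilon> \<Longrightarrow> z \<in> \<Omega>" using a(1) ball_subset_cball by blast
    then show ?case
      using elim radial_field_eq_0[of z a \<epsilon> j] a(2) by fastforce
  qed
  moreover have op: "open {z. radial_field a \<epsilon> j z \<noteq> 0}"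
    using continuous_on_radial_field[of UNIV a \<epsilon> j]
    by (intro open_Collect_neq) auto
  ultimately have "negligible {z. radial_field a \<epsilon> j z \<noteq> 0}"
    by (auto simp: negligible_iff_null_sets AE_iff_null_sets)
  \<comment> \<open>The field vanishes at the centre through its factor
    \<open>z $ j - a $ j\<close>, so the witness is moved half a radius along that
    coordinate.\<close>
  moreover have "radial_field a \<epsilon> j (a + axis j (of_real (\<epsilon> / 2))) \<noteq> 0"
  proof -
    have "\<epsilon>\<^sup>2 - axis j (complex_of_real (\<epsilon> / 2)) \<bullet> axis j (of_real (\<epsilon> / 2)) = 3 / 4 * \<epsilon>\<^sup>2"
      by (simp add: inner_axis_axis inner_complex_def power2_eq_square)
    moreover have "3 / 4 * \<epsilon>\<^sup>2 > 0" using a by simp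
    ultimately show ?thesis
      using a by (simp add: radial_field_def)
  qed
  ultimately show False using open_not_negligible[OF op] by blast
qed

lemma ex_unit_K2_form_in_ball:
  fixes \<Omega> :: "(complex ^ 'n::{finite,linorder}) set"
  assumes \<Omega>: "open \<Omega>" "bounded \<Omega>" and pq: "p \<le> CARD('n)" "1 \<le> q" "q \<le> CARD('n)"
    and a: "cball a \<epsilon> \<subseteq> \<Omega>" "0 < \<epsilon>"
  obtains f where "f \<in> K2_forms \<Omega> p q" "L2_norm \<Omega> f = 1" "\<And>z I J. z \<notin> ball a \<epsilon> \<Longrightarrow> f z I J = 0"
proof -
  obtain I :: "'n set" where I: "card I = p"
    using pq(1) obtain_subset_with_card_n by metis
  obtain J :: "'n set" where J: "card J = q"
    using pq(3) obtain_subset_with_card_n by metis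
  then obtain j where j: "j \<in> J" using pq(2) by fastforce
  let ?g = "bump_form a \<epsilon> I (J - {j})"
  have g: "?g \<in> K2_forms \<Omega> p q"
  proof (rule bump_form_K2_forms[OF \<Omega> I _ a])
    show "card (J - {j}) + 1 = q" using J j by (metis Suc_eq_plus1 card_Suc_Diff1 finite)
  qed
  have pos: "0 < L2_norm \<Omega> ?g" using L2_norm_bump_form_pos[OF \<Omega> j a] .
  let ?c = "complex_of_real (1 / L2_norm \<Omega> ?g)"
  have "form_scale ?c ?g \<in> K2_forms \<Omega> p q"
    using K2_forms_scale[OF \<Omega> g] .
  moreover have "L2_norm \<Omega> (form_scale ?c ?g) = 1"
    using pos by (simp add: L2_norm_scale norm_divide)
  moreover have "form_scale ?c ?g z I' J' = 0" if "z \<notin> ball a \<epsilon>" for z I' J'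
    using bump_form_eq_0[OF that] a by (simp add: form_mult_def)
  ultimately show thesis by (rule that)
qed

subsection \<open>Compactness\<close>

text \<open>The difference is the integral of \<open>(\<phi> - w)\<close> times the squared modulus
  of \<open>f\<close>, so \<open>\<phi>\<close> needs control only where \<open>f\<close> is
  nonzero.\<close>

lemma L2_inner_mult_near_constant:
  assumes \<phi>: "\<phi> \<in> Linf \<Omega>" and f: "f \<in> L2_forms \<Omega> p q"
    and le: "\<And>z I J. f z I J \<noteq> 0 \<Longrightarrow> cmod (\<phi> z - w) \<le> \<delta>"
  shows "cmod (L2_inner \<Omega> (form_mult \<phi> f) f - w * of_real ((L2_norm \<Omega> f)\<^sup>2)) \<le> \<delta> * (L2_norm \<Omega> f)\<^sup>2"
proof -
  let ?M = "lebesgue_on \<Omega>"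
  let ?d = "form_diff (form_mult \<phi> f) (form_scale w f)"
  have mL: "form_mult \<phi> f \<in> L2_forms \<Omega> p q" using form_mult_L2_forms[OF \<phi> f] .
  have dL: "?d \<in> L2_forms \<Omega> p q" using L2_forms_diff_scale[OF mL f] .
  have "cmod (\<integral>z. ?d z I J * cnj (f z I J) \<partial>?M) \<le> (\<integral>z. \<delta> * (cmod (f z I J))\<^sup>2 \<partial>?M)" for I J
  proof (rule Bochner_Integration.integral_norm_bound_integral)
    show "integrable ?M (\<lambda>z. ?d z I J * cnj (f z I J))"
      using L2_forms_integrable_mult[OF dL f] .
    show "integrable ?M (\<lambda>z. \<delta> * (cmod (f z I J))\<^sup>2)"
      by (intro integrable_mult_right L2_formsD(2)[OF f])
    fix z
    have "?d z I J * cnj (f z I J) = (\<phi> z - w) * (f z I J * cnj (f z I J))"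
      by (simp add: form_diff_def form_mult_def algebra_simps)
    then have "norm (?d z I J * cnj (f z I J)) = cmod (\<phi> z - w) * (cmod (f z I J))\<^sup>2"
      by (simp only: norm_mult complex_mod_cnj power2_eq_square)
    also have "\<dots> \<le> \<delta> * (cmod (f z I J))\<^sup>2"
      using le[of z I J] by (cases "f z I J = 0") (auto intro: mult_right_mono)
    finally show "norm (?d z I J * cnj (f z I J)) \<le> \<delta> * (cmod (f z I J))\<^sup>2" .
  qed
  then have "cmod (L2_inner \<Omega> ?d f) \<le> (\<Sum>I\<in>UNIV. \<Sum>J\<in>UNIV. \<integral>z. \<delta> * (cmod (f z I J))\<^sup>2 \<partial>?M)"
    unfolding L2_inner_def by (intro order_trans[OF norm_sum] sum_mono) auto
  also have "\<dots> = \<delta> * (L2_norm \<Omega> f)\<^sup>2"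
    by (simp add: L2_norm_power2 sum_distrib_left)
  finally show ?thesis
    by (simp add: L2_inner_diff_scale[OF mL f f] L2_inner_self)
qed

lemma ex_disjoint_balls_in_ball:
  fixes z\<^sub>0 :: "complex ^ 'n"
  assumes "0 < R"
  obtains a :: "nat \<Rightarrow> complex ^ 'n" and \<epsilon> :: "nat \<Rightarrow> real"
  where "\<And>k. 0 < \<epsilon> k" "\<And>k. cball (a k) (\<epsilon> k) \<subseteq> ball z\<^sub>0 R"
    "\<And>k l. k \<noteq> l \<Longrightarrow> ball (a k) (\<epsilon> k) \<inter> ball (a l) (\<epsilon> l) = {}"
proof -
  obtain e :: "complex ^ 'n" where e: "norm e = 1"
    using vector_choose_size[of 1] by auto
  \<comment> \<open>Centres approach \<open>z\<^sub>0\<close> along a segment. For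
    \<open>k < l\<close> they are at least \<open>R / 4 * (1/2)^k\<close> apart, while the two radii
    sum to at most \<open>3 * R / 16 * (1/2)^k\<close>.\<close>
  define a where "a k = z\<^sub>0 + (R / 2 * (1/2)^k) *\<^sub>R e" for k :: nat
  define \<epsilon> where "\<epsilon> k = R / 8 * (1/2)^k" for k :: nat
  have pos: "0 < \<epsilon> k" for k using assms by (simp add: \<epsilon>_def)
  have "cball (a k) (\<epsilon> k) \<subseteq> ball z\<^sub>0 R" for k
  proof -
    have "(1/2::real)^k \<le> 1" by (simp add: power_le_one)
    then have "R * (1/2::real)^k \<le> R" using assms by simp
    then have "dist (a k) z\<^sub>0 + \<epsilon> k < R"
      using assms e by (simp add: a_def \<epsilon>_def dist_norm)
    then show ?thesis by (simp add: cball_subset_ball_iff)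
  qed
  moreover have disj: "ball (a k) (\<epsilon> k) \<inter> ball (a l) (\<epsilon> l) = {}" if "k < l" for k l
  proof -
    have "(1/2::real)^l \<le> (1/2)^Suc k"
      using that by (intro power_decreasing) auto
    then have le: "R * (1/2::real)^l \<le> R * (1/2)^k / 2" using assms by (simp add: field_simps)
    have "a k - a l = (R / 2 * (1/2)^k - R / 2 * (1/2)^l) *\<^sub>R e"
      by (simp add: a_def scaleR_diff_left)
    then have "dist (a k) (a l) = \<bar>R / 2 * (1/2)^k - R / 2 * (1/2)^l\<bar>"
      using e by (simp add: dist_norm)
    moreover have "0 < R * (1/2)^k" using assms by simp
    ultimately have "\<epsilon> k + \<epsilon> l \<le> dist (a k) (a l)"
      using le unfolding \<epsilon>_def by linarith
    then show ?thesis by (rule disjoint_ballI)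
  qed
  moreover have "ball (a k) (\<epsilon> k) \<inter> ball (a l) (\<epsilon> l) = {}" if "k \<noteq> l" for k l
    using disj[of k l] disj[of l k] that by (cases "k < l") auto
  ultimately show thesis using that pos by metis
qed

theorem theorem2:
  fixes \<Omega> :: "(complex ^ 'n::{finite,linorder}) set"
    and p q :: nat
    and \<phi> :: "complex ^ 'n::{finite,linorder} \<Rightarrow> complex"
  assumes "domain_set \<Omega>" and "bounded \<Omega>" and "pseudoconvex \<Omega>"
    and "0 \<le> p" and "p \<le> CARD('n)" and "1 \<le> q" and "q \<le> CARD('n)"
    and "continuous_on \<Omega> \<phi>" and "\<phi> \<in> Linf \<Omega>"
  shows "compact_on_K2 \<Omega> p q (toeplitz \<Omega> p q \<phi>) \<longleftrightarrow> (\<forall>z\<in>\<Omega>. \<phi> z = 0)"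
proof
  have \<Omega>: "open \<Omega>" "bounded \<Omega>" using assms by (auto simp: domain_set_def)
  note T = toeplitz_spec[OF \<Omega> \<open>\<phi> \<in> Linf \<Omega>\<close>]
  have KL: "g \<in> L2_forms \<Omega> p q" if "g \<in> K2_forms \<Omega> p q" for g
    using that by (simp add: K2_forms_def)
  {
    assume \<phi>0: "\<forall>z\<in>\<Omega>. \<phi> z = 0"
    have zero: "(\<lambda>z I J. 0) \<in> K2_forms \<Omega> p q"
      using zero_L2_forms by (auto simp: K2_forms_def weak_dbar_def)
    \<comment> \<open>The chosen representative of the value need not be the zero function; its norm
      is found by pairing it with itself, which is allowed since it is closed.\<close>
    have "L2_norm \<Omega> (form_diff (toeplitz \<Omega> p q \<phi> f) (\<lambda>z I J. 0)) = 0" if f: "f \<in> K2_forms \<Omega> p q" for f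
    proof -
      have "L2_inner \<Omega> (form_mult \<phi> f) h = 0" for h
      proof -
        have "(\<integral>z. form_mult \<phi> f z I J * cnj (h z I J) \<partial>lebesgue_on \<Omega>) = (\<integral>z. 0 \<partial>lebesgue_on \<Omega>)" for I J
          using \<phi>0 by (intro Bochner_Integration.integral_cong) (auto simp: form_mult_def)
        then show ?thesis by (simp add: L2_inner_def)
      qed
      then have "L2_inner \<Omega> (toeplitz \<Omega> p q \<phi> f) (toeplitz \<Omega> p q \<phi> f) = 0"
        using T(2)[OF f T(1)[OF f]] by simp
      then show ?thesis by (simp add: L2_inner_self form_diff_def)
    qed
    then show "compact_on_K2 \<Omega> p q (toeplitz \<Omega> p q \<phi>)"
      unfolding compact_on_K2_def using zero
      by (intro allI impI exI[of _ id] exI[of _ "\<lambda>z I J. 0"]) (auto simp: strict_mono_def)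
  }
  assume comp: "compact_on_K2 \<Omega> p q (toeplitz \<Omega> p q \<phi>)"
  show "\<forall>z\<in>\<Omega>. \<phi> z = 0"
  proof (rule ccontr)
    assume "\<not> (\<forall>z\<in>\<Omega>. \<phi> z = 0)"
    then obtain z\<^sub>0 where z\<^sub>0: "z\<^sub>0 \<in> \<Omega>" "\<phi> z\<^sub>0 \<noteq> 0" by blast
    \<comment> \<open>Half the modulus: a pairing within \<open>\<delta>\<close> of
      \<open>\<phi> z\<^sub>0\<close> still has modulus at least \<open>\<delta>\<close>.\<close>
    define \<delta> where "\<delta> = cmod (\<phi> z\<^sub>0) / 2"
    have \<delta>: "\<delta> > 0" using z\<^sub>0 by (simp add: \<delta>_def)
    obtain R\<^sub>1 where R\<^sub>1: "R\<^sub>1 > 0" "ball z\<^sub>0 R\<^sub>1 \<subseteq> \<Omega>"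
      using \<Omega> z\<^sub>0 open_contains_ball by blast
    obtain R\<^sub>2 where R\<^sub>2: "R\<^sub>2 > 0" "\<And>z. z \<in> \<Omega> \<Longrightarrow> dist z z\<^sub>0 < R\<^sub>2 \<Longrightarrow> dist (\<phi> z) (\<phi> z\<^sub>0) < \<delta>"
      using \<open>continuous_on \<Omega> \<phi>\<close> z\<^sub>0 \<delta> unfolding continuous_on_iff by blast
    define R where "R = min R\<^sub>1 R\<^sub>2"
    have R: "R > 0" "ball z\<^sub>0 R \<subseteq> \<Omega>" using R\<^sub>1 R\<^sub>2 by (auto simp: R_def)
    have near: "cmod (\<phi> z - \<phi> z\<^sub>0) \<le> \<delta>" if "z \<in> ball z\<^sub>0 R" for z
    proof -
      have "z \<in> \<Omega>" using that R by blast
      moreover have "dist z z\<^sub>0 < R\<^sub>2" using that by (simp add: R_def dist_commute)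
      ultimately show ?thesis using R\<^sub>2(2)[of z] by (simp add: dist_norm)
    qed
    obtain a \<epsilon> where \<epsilon>: "\<And>k::nat. 0 < \<epsilon> k" and a: "\<And>k. cball (a k) (\<epsilon> k) \<subseteq> ball z\<^sub>0 R"
      and disj: "\<And>k l. k \<noteq> l \<Longrightarrow> ball (a k) (\<epsilon> k) \<inter> ball (a l) (\<epsilon> l) = {}"
      using ex_disjoint_balls_in_ball[OF R(1), of z\<^sub>0] by metis
    have "\<exists>f. f \<in> K2_forms \<Omega> p q \<and> L2_norm \<Omega> f = 1 \<and> (\<forall>z I J. z \<notin> ball (a k) (\<epsilon> k) \<longrightarrow> f z I J = 0)" for k
      using ex_unit_K2_form_in_ball[OF \<Omega> \<open>p \<le> CARD('n)\<close> \<open>1 \<le> q\<close> \<open>q \<le> CARD('n)\<close>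
          order_trans[OF a R(2)] \<epsilon>, of k] by metis
    then obtain F where F: "\<And>k. F k \<in> K2_forms \<Omega> p q" "\<And>k. L2_norm \<Omega> (F k) = 1"
      "\<And>k z I J. z \<notin> ball (a k) (\<epsilon> k) \<Longrightarrow> F k z I J = 0"
      by metis
    let ?T = "toeplitz \<Omega> p q \<phi>"
    have diag: "\<delta> \<le> cmod (L2_inner \<Omega> (?T (F k)) (F k))" for k
    proof -
      have "cmod (\<phi> z - \<phi> z\<^sub>0) \<le> \<delta>" if "F k z I J \<noteq> 0" for z I J
      proof (rule near)
        have "z \<in> ball (a k) (\<epsilon> k)" using F(3) that by blast
        then show "z \<in> ball z\<^sub>0 R" using a ball_subset_cball by blast
      qed
      from L2_inner_mult_near_constant[OF \<open>\<phi> \<in> Linf \<Omega>\<close> KL[OF F(1)] this]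
      have "cmod (L2_inner \<Omega> (?T (F k)) (F k) - \<phi> z\<^sub>0) \<le> \<delta>"
        using T(2)[OF F(1) F(1)] F(2) by simp
      then show ?thesis
        using norm_triangle_sub[of "\<phi> z\<^sub>0" "L2_inner \<Omega> (?T (F k)) (F k)"]
        by (simp add: \<delta>_def norm_minus_commute)
    qed
    have off: "L2_inner \<Omega> (?T (F l)) (F k) = 0" if "k \<noteq> l" for k l
    proof -
      have "F l z I J = 0 \<or> F k z I J = 0" for z I J
        using F(3)[of z k I J] F(3)[of z l I J] disj[OF that] by blast
      then have prod_0: "form_mult \<phi> (F l) z I J * cnj (F k z I J) = 0" for z I J
        by (auto simp: form_mult_def)
      have "L2_inner \<Omega> (form_mult \<phi> (F l)) (F k) = 0"
        unfolding L2_inner_def prod_0 by simp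
      then show ?thesis by (simp only: T(2)[OF F(1) F(1)])
    qed
    obtain r g where r: "strict_mono (r :: nat \<Rightarrow> nat)" and g: "g \<in> K2_forms \<Omega> p q"
      and lim: "(\<lambda>k. L2_norm \<Omega> (form_diff (?T (F (r k))) g)) \<longlonglongrightarrow> 0"
      using comp[unfolded compact_on_K2_def, rule_format, of F] F(1,2) by (metis order_refl)
    define e where "e k = L2_norm \<Omega> (form_diff (?T (F (r k))) g)" for k
    \<comment> \<open>Both \<open>T (F (r k))\<close> and \<open>T (F (r (Suc k)))\<close> are
      compared with \<open>g\<close> through their pairings with the unit form
      \<open>F (r k)\<close>: the first pairing has modulus at least \<open>\<delta>\<close>, the
      second is 0.\<close>
    have "\<delta> \<le> e k + e (Suc k)" for k
    proof -
      let ?f = "F (r k)"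
      have bound: "cmod (L2_inner \<Omega> (?T (F (r l))) ?f - L2_inner \<Omega> g ?f) \<le> e l" for l
        using L2_Cauchy_Schwarz[OF L2_forms_diff[OF KL[OF T(1)[OF F(1)]] KL[OF g]] KL[OF F(1)], of "r l" "r k"]
          L2_inner_diff[OF KL[OF T(1)[OF F(1)]] KL[OF g] KL[OF F(1)], of "r l" "r k"] F(2)
        by (simp add: e_def)
      have "r k \<noteq> r (Suc k)" using strict_monoD[OF r, of k "Suc k"] by simp
      then have "cmod (L2_inner \<Omega> g ?f) \<le> e (Suc k)" using bound[of "Suc k"] off by simp
      then show ?thesis
        using diag[of "r k"] bound[of k] norm_triangle_sub[of "L2_inner \<Omega> (?T ?f) ?f" "L2_inner \<Omega> g ?f"]
        by linarith
    qed
    moreover have "(\<lambda>k. e k + e (Suc k)) \<longlonglongrightarrow> 0 + 0"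
      using lim unfolding e_def by (intro tendsto_add LIMSEQ_Suc)
    ultimately have "\<delta> \<le> 0" using LIMSEQ_le_const[of "\<lambda>k. e k + e (Suc k)" 0 \<delta>] by auto
    with \<delta> show False by simp
  qed
qed

end
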